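(* Let $\varphi$ be any $\omega$-Thiele's rule such that $\omega(2)<2\omega(1)$. Then the problem DCDC for seq$\varphi$ is W[1]-hard when parameterized by $m-\ell$ (the number of candidates not deleted), where $m=|C|$. Moreover, this holds even when there is only one distinguished candidate, i.e., $|J|=1$.
   Context: An election is a pair $(C,V)$, where $C$ is a finite set of candidates and $V$ is a multiset of votes, each vote being a subset of $C$; a vote $v$ approves $c$ if $c\in v$. For $C'\subseteq C$, the election $(C',V)$ is obtained by replacing every vote $v$ by $v\cap C'$. A $k$-committee is a $k$-element subset of the candidate set. An $\omega$-Thiele's rule $\varphi$ is characterized by a (fixed) function $\omega:\mathbb{N}\to\mathbb{R}$ (with $0\in\mathbb{N}$) such that $\omega(0)=0$ and $\omega(i+1)\ge\omega(i)$ for all nonnegative integers $i$. The $\varphi$ score of $w\subseteq C$ in $(C,V)$ is $\sum_{v\in V}\omega(|v\cap w|)$. The $\varphi$ margin contribution of $c\in C$ to $w\subseteq C$ is the $\varphi$ score of $w\cup\{c\}$ minus the $\varphi$ score of $w$. The sequential rule seq$\varphi$ determines a single winning $k$-committee $w$ as follows: start with $w=\emptyset$; in each iteration add to $w$ a candidate from $C\setminus w$ with maximum $\varphi$ margin contribution to $w$, ties being broken by a linear order over the candidates (given with the instance); stop when $|w|=k$. Destructive Control by Deleting Candidates (DCDC) for a rule $\psi$. Input: an election $(C,V)$, an integer $k\le|C|$, a nonempty subset $J\subseteq C$ (distinguished candidates), and an integer $\ell\le|C|-k$. Question: is there $C'\subseteq C\setminus J$ with $|C'|\le\ell$ and $|C\setminus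 C'|\ge k$ such that no candidate of $J$ belongs to any winning $k$-committee of $\psi$ at $(C\setminus C',V)$? *)

theory Defs
  imports Complex_Main "HOL-Library.Multiset"
begin

section \<open>A model of computation\<close>

text \<open>
  Inputs and outputs are binary trees, measured by their number of nodes (which is, up to a
  constant factor, the length of the string obtained by writing the tree with parentheses).
\<close>

datatype data = Atom | Node data data

primrec len :: "data \<Rightarrow> nat" where
  "len Atom = 1"
| "len (Node x y) = Suc (len x + len y)"

text \<open>
  Programs are while-programs with a single tree-valued variable; several variables are
  simulated by packing them into one tree.  \<open>Atom\<close> is the truth value false,
  every other tree is true.
\<close>

datatype prog =
    PId | PAtom | PHead | PTail
  | PPair prog prog
  | PSeq prog prog
  | PIf prog prog prog
  | PWhile prog prog

text \<open>
  \<open>exec p x t y\<close>: on input \<open>x\<close> the program \<open>p\<close> halts with output \<open>y\<close> at cost \<open>t\<close>.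
  An elementary step is charged the size of the whole tree it is applied to, so that copying is
  never free, the sizes of all intermediate trees are bounded by the cost
  (\<open>exec_output_len\<close> below), and cost is polynomially related to running time on
  Turing machines.
\<close>

inductive exec :: "prog \<Rightarrow> data \<Rightarrow> nat \<Rightarrow> data \<Rightarrow> bool" where
  Id: "exec PId x (len x) x"
| Atom: "exec PAtom x (len x) Atom"
| Head_Atom: "exec PHead Atom (len Atom) Atom"
| Head_Node: "exec PHead (Node x y) (len (Node x y)) x"
| Tail_Atom: "exec PTail Atom (len Atom) Atom"
| Tail_Node: "exec PTail (Node x y) (len (Node x y)) y"
| Pair: "exec p x t y \<Longrightarrow> exec q x u z \<Longrightarrow> exec (PPair p q) x (Suc (t + u)) (Node y z)"
| Seq: "exec p x t y \<Longrightarrow> exec q y u z \<Longrightarrow> exec (PSeq p q) x (Suc (t + u)) z"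
| If_True: "exec b x t v \<Longrightarrow> v \<noteq> Atom \<Longrightarrow> exec p x u y \<Longrightarrow> exec (PIf b p q) x (Suc (t + u)) y"
| If_False: "exec b x t Atom \<Longrightarrow> exec q x u y \<Longrightarrow> exec (PIf b p q) x (Suc (t + u)) y"
| While_False: "exec b x t Atom \<Longrightarrow> exec (PWhile b p) x (Suc t) x"
| While_True: "exec b x t v \<Longrightarrow> v \<noteq> Atom \<Longrightarrow> exec p x u y \<Longrightarrow> exec (PWhile b p) y s z
    \<Longrightarrow> exec (PWhile b p) x (Suc (t + u + s)) z"

lemma exec_deterministic:
  assumes "exec p x t y" "exec p x t' y'"
  shows "t = t' \<and> y = y'"
  using assms
proof (induction arbitrary: t' y' rule: exec.induct)
  case (Id x)
  then show ?case by (auto elim: exec.cases)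
next
  case (Atom x)
  then show ?case by (auto elim: exec.cases)
next
  case Head_Atom
  then show ?case by (auto elim: exec.cases)
next
  case (Head_Node x y)
  then show ?case by (auto elim: exec.cases)
next
  case Tail_Atom
  then show ?case by (auto elim: exec.cases)
next
  case (Tail_Node x y)
  then show ?case by (auto elim: exec.cases)
next
  case (Pair p x t y q u z)
  from Pair.prems show ?case by (cases rule: exec.cases) (use Pair.IH in blast)+
next
  case (Seq p x t y q u z)
  from Seq.prems show ?case by (cases rule: exec.cases) (use Seq.IH in blast)+
next
  case (If_True b x t v p u y q)
  from If_True.prems show ?case
    by (cases rule: exec.cases) (use If_True.IH If_True.hyps in blast)+
next
  case (If_False b x t q u y p)
  from If_False.prems show ?case
    by (cases rule: exec.cases) (use If_False.IH If_False.hyps in blast)+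
next
  case (While_False b x t p)
  from While_False.prems show ?case
    by (cases rule: exec.cases) (use While_False.IH in blast)+
next
  case (While_True b x t v p u y s z)
  from While_True.prems show ?case
    by (cases rule: exec.cases) (use While_True.IH While_True.hyps in blast)+
qed

lemma exec_input_len: "exec p x t y \<Longrightarrow> len x \<le> t"
  by (induction rule: exec.induct) auto

lemma exec_output_len: "exec p x t y \<Longrightarrow> len y \<le> t"
proof (induction rule: exec.induct)
  case (Atom x)
  show ?case by (cases x) auto
next
  case (While_False b x t p)
  then show ?case using exec_input_len by fastforce
qed auto

primrec num :: "nat \<Rightarrow> data" where
  "num 0 = Atom"
| "num (Suc n) = Node Atom (num n)"

primrec lst :: "data list \<Rightarrow> data" where
  "lst [] = Atom"
| "lst (x # xs) = Node x (lst xs)"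

definition computable :: "(nat \<Rightarrow> nat) \<Rightarrow> bool" where
  "computable g \<longleftrightarrow> (\<exists>p. \<forall>n. \<exists>t. exec p (num n) t (num (g n)))"


section \<open>Parameterized problems and W[1]-hardness\<close>

text \<open>A parameterized problem is a set of pairs (instance, parameter).\<close>

type_synonym pproblem = "(data \<times> nat) set"

definition fpt_reducible :: "pproblem \<Rightarrow> pproblem \<Rightarrow> bool" where
  "fpt_reducible A B \<longleftrightarrow>
    (\<exists>p g h c. computable g \<and> computable h \<and>
      (\<forall>x k. \<exists>x' k' t.
        exec p (Node x (num k)) t (Node x' (num k')) \<and>
        t \<le> g k * len x ^ c \<and>
        k' \<le> h k \<and>
        ((x, k) \<in> A \<longleftrightarrow> (x', k') \<in> B)))"

text \<open>
  The W-hierarchy is defined as by Flum and Grohe (Parameterized Complexity Theory, Chapter 5):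
  W[t] is the closure under fpt-reductions of the problems p-WD-phi, where phi(X) ranges
  over the first-order formulas of prefix class Pi-t with one free relation variable X.  An
  instance of p-WD-phi is a finite structure together with the parameter k, and the question is
  whether phi(S) holds in the structure for some relation S with exactly k tuples.

  For t = 1 the formula phi(X) is a quantifier-free formula \<open>\<psi>\<close>, preceded by \<open>r\<close> universal
  quantifiers binding the variables 0, ..., r - 1.  A vocabulary is the list \<open>\<tau>\<close> of the
  arities of its relation symbols, and \<open>s\<close> is the arity of X.
\<close>

datatype qf =
    Rel nat "nat list"
  | SetVar "nat list"
  | Eq nat nat
  | Neg qf
  | Conj qf qf
  | Disj qf qf

primrec wf_qf :: "nat list \<Rightarrow> nat \<Rightarrow> nat \<Rightarrow> qf \<Rightarrow> bool" where
  "wf_qf \<tau> s r (Rel i ys) \<longleftrightarrow> i < length \<tau> \<and> length ys = \<tau> ! i \<and> set ys \<subseteq> {..<r}"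
| "wf_qf \<tau> s r (SetVar ys) \<longleftrightarrow> length ys = s \<and> set ys \<subseteq> {..<r}"
| "wf_qf \<tau> s r (Eq y z) \<longleftrightarrow> y < r \<and> z < r"
| "wf_qf \<tau> s r (Neg \<psi>) \<longleftrightarrow> wf_qf \<tau> s r \<psi>"
| "wf_qf \<tau> s r (Conj \<psi> \<chi>) \<longleftrightarrow> wf_qf \<tau> s r \<psi> \<and> wf_qf \<tau> s r \<chi>"
| "wf_qf \<tau> s r (Disj \<psi> \<chi>) \<longleftrightarrow> wf_qf \<tau> s r \<psi> \<and> wf_qf \<tau> s r \<chi>"

primrec sat :: "nat list set list \<Rightarrow> nat list set \<Rightarrow> nat list \<Rightarrow> qf \<Rightarrow> bool" where
  "sat Rs S a (Rel i ys) \<longleftrightarrow> map (\<lambda>y. a ! y) ys \<in> Rs ! i"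
| "sat Rs S a (SetVar ys) \<longleftrightarrow> map (\<lambda>y. a ! y) ys \<in> S"
| "sat Rs S a (Eq y z) \<longleftrightarrow> a ! y = a ! z"
| "sat Rs S a (Neg \<psi>) \<longleftrightarrow> \<not> sat Rs S a \<psi>"
| "sat Rs S a (Conj \<psi> \<chi>) \<longleftrightarrow> sat Rs S a \<psi> \<and> sat Rs S a \<chi>"
| "sat Rs S a (Disj \<psi> \<chi>) \<longleftrightarrow> sat Rs S a \<psi> \<or> sat Rs S a \<chi>"

definition tuples :: "nat \<Rightarrow> nat \<Rightarrow> nat list set" where
  "tuples n s = {a. length a = s \<and> set a \<subseteq> {..<n}}"

text \<open>A structure has universe \<open>{..<n}\<close>; each relation is given by a list of its tuples.\<close>

definition wf_struct :: "nat list \<Rightarrow> nat \<Rightarrow> nat list list list \<Rightarrow> bool" where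
  "wf_struct \<tau> n rels \<longleftrightarrow> 0 < n \<and> length rels = length \<tau> \<and>
    (\<forall>i < length \<tau>. distinct (rels ! i) \<and> set (rels ! i) \<subseteq> tuples n (\<tau> ! i))"

definition enc_struct :: "nat \<Rightarrow> nat list list list \<Rightarrow> data" where
  "enc_struct n rels =
    Node (num n) (lst (map (\<lambda>ts. lst (map (\<lambda>a. lst (map num a)) ts)) rels))"

definition WD :: "nat list \<Rightarrow> nat \<Rightarrow> nat \<Rightarrow> qf \<Rightarrow> pproblem" where
  "WD \<tau> s r \<psi> = {(enc_struct n rels, k) | n rels k.
    wf_struct \<tau> n rels \<and>
    (\<exists>S. S \<subseteq> tuples n s \<and> card S = k \<and> (\<forall>a \<in> tuples n r. sat (map set rels) S a \<psi>))}"

definition W1 :: "pproblem set" where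
  "W1 = {A. \<exists>\<tau> s r \<psi>. wf_qf \<tau> s r \<psi> \<and> fpt_reducible A (WD \<tau> s r \<psi>)}"

definition W1_hard :: "pproblem \<Rightarrow> bool" where
  "W1_hard B \<longleftrightarrow> (\<forall>A \<in> W1. fpt_reducible A B)"


section \<open>Elections and sequential Thiele rules\<close>

definition is_thiele :: "(nat \<Rightarrow> real) \<Rightarrow> bool" where
  "is_thiele \<omega> \<longleftrightarrow> \<omega> 0 = 0 \<and> (\<forall>i. \<omega> i \<le> \<omega> (Suc i))"

definition score :: "(nat \<Rightarrow> real) \<Rightarrow> 'c set multiset \<Rightarrow> 'c set \<Rightarrow> real" where
  "score \<omega> V w = (\<Sum>v\<in>#V. \<omega> (card (v \<inter> w)))"

definition margin :: "(nat \<Rightarrow> real) \<Rightarrow> 'c set multiset \<Rightarrow> 'c set \<Rightarrow> 'c \<Rightarrow> real" where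
  "margin \<omega> V w c = score \<omega> V (w \<union> {c}) - score \<omega> V w"

definition restrict_votes :: "'c set \<Rightarrow> 'c set multiset \<Rightarrow> 'c set multiset" where
  "restrict_votes C V = image_mset (\<lambda>v. v \<inter> C) V"

text \<open>
  A multiwinner rule maps candidates, votes, a tie-breaking order and a committee size to
  the set of winning committees.  In a tie-breaking order \<open>R\<close>, \<open>(c, d) \<in> R\<close> means that
  \<open>c\<close> is preferred to \<open>d\<close> (or \<open>c = d\<close>).
\<close>

type_synonym 'c rule = "'c set \<Rightarrow> 'c set multiset \<Rightarrow> 'c rel \<Rightarrow> nat \<Rightarrow> 'c set set"

definition selected ::
  "(nat \<Rightarrow> real) \<Rightarrow> 'c set \<Rightarrow> 'c set multiset \<Rightarrow> 'c rel \<Rightarrow> 'c set \<Rightarrow> 'c \<Rightarrow> bool" where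
  "selected \<omega> C V R w c \<longleftrightarrow> c \<in> C - w \<and>
    (\<forall>d \<in> C - w. margin \<omega> V w d < margin \<omega> V w c \<or>
      margin \<omega> V w d = margin \<omega> V w c \<and> (c, d) \<in> R)"

inductive seq_reach ::
  "(nat \<Rightarrow> real) \<Rightarrow> 'c set \<Rightarrow> 'c set multiset \<Rightarrow> 'c rel \<Rightarrow> 'c set \<Rightarrow> bool"
  for \<omega> C V R where
  empty: "seq_reach \<omega> C V R {}"
| insert: "seq_reach \<omega> C V R w \<Longrightarrow> selected \<omega> C V R w c \<Longrightarrow> seq_reach \<omega> C V R (insert c w)"

definition seq_thiele :: "(nat \<Rightarrow> real) \<Rightarrow> 'c rule" where
  "seq_thiele \<omega> C V R k = {w. seq_reach \<omega> C V R w \<and> card w = k}"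

lemma seq_reach_subset: "seq_reach \<omega> C V R w \<Longrightarrow> w \<subseteq> C"
  by (induction rule: seq_reach.induct) (auto simp: selected_def)

lemma selected_unique:
  assumes "linear_order_on C R" "selected \<omega> C V R w c" "selected \<omega> C V R w d"
  shows "c = d"
proof -
  have "(c, d) \<in> R" "(d, c) \<in> R"
    using assms(2,3) unfolding selected_def by (metis less_asym)+
  then show ?thesis
    using assms(1) unfolding linear_order_on_def partial_order_on_def antisym_def by blast
qed

lemma selected_exists:
  assumes "linear_order_on C R" "finite C" "C - w \<noteq> {}"
  shows "\<exists>c. selected \<omega> C V R w c"
proof -
  let ?f = "margin \<omega> V w"
  define M where "M = {c \<in> C - w. \<forall>d \<in> C - w. ?f d \<le> ?f c}"
  have fin: "finite M" using assms(2) by (simp add: M_def)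
  have ne: "M \<noteq> {}"
    using Max_in[of "?f ` (C - w)"] Max_ge[of "?f ` (C - w)"] assms(2,3)
    by (fastforce simp: M_def)
  have least: "\<exists>c\<in>A. \<forall>d\<in>A. (c, d) \<in> R" if "finite A" "A \<noteq> {}" "A \<subseteq> C" for A
    using that
  proof (induction rule: finite_ne_induct)
    case (singleton x)
    then show ?case
      using assms(1)
      by (auto simp: linear_order_on_def partial_order_on_def preorder_on_def refl_on_def)
  next
    case (insert x A)
    then obtain c where c: "c \<in> A" "\<forall>d\<in>A. (c, d) \<in> R" by auto
    have rxx: "(x, x) \<in> R" and tr: "trans R" and xc: "(x, c) \<in> R \<or> (c, x) \<in> R"
      using assms(1) insert.prems insert.hyps c(1)
      by (auto simp: linear_order_on_def partial_order_on_def preorder_on_def refl_on_def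
          total_on_def)
    from xc show ?case
    proof
      assume "(x, c) \<in> R"
      then have "\<forall>d\<in>insert x A. (x, d) \<in> R" using c(2) rxx tr by (auto dest: transD)
      then show ?thesis by blast
    next
      assume "(c, x) \<in> R"
      then show ?thesis using c by blast
    qed
  qed
  obtain c where c: "c \<in> M" "\<forall>d\<in>M. (c, d) \<in> R"
    using least[OF fin ne] by (auto simp: M_def)
  have "selected \<omega> C V R w c"
    unfolding selected_def
  proof (intro conjI ballI)
    show "c \<in> C - w" using c(1) by (simp add: M_def)
    fix d assume d: "d \<in> C - w"
    show "?f d < ?f c \<or> ?f d = ?f c \<and> (c, d) \<in> R"
    proof (cases "?f d < ?f c")
      case False
      then have "?f d = ?f c" using c(1) d by (force simp: M_def)
      moreover from this have "d \<in> M" using c(1) d by (auto simp: M_def)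
      ultimately show ?thesis using c(2) by blast
    qed blast
  qed
  then show ?thesis by blast
qed

lemma seq_thiele_singleton:
  fixes C :: "'c set"
  assumes "linear_order_on C R" "finite C" "k \<le> card C"
  shows "\<exists>w. seq_thiele \<omega> C V R k = {w}"
  using assms(3)
proof (induction k)
  case 0
  have "seq_thiele \<omega> C V R 0 = {{}}"
  proof (rule set_eqI)
    fix w
    have "w = {}" if "seq_reach \<omega> C V R w" "card w = 0"
    proof -
      have "finite w" using seq_reach_subset[OF that(1)] assms(2) by (rule finite_subset)
      then show ?thesis using that(2) by simp
    qed
    then show "w \<in> seq_thiele \<omega> C V R 0 \<longleftrightarrow> w \<in> {{}}"
      unfolding seq_thiele_def mem_Collect_eq singleton_iff
      by (metis card.empty seq_reach.empty)
  qed
  then show ?case by (rule exI)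
next
  case (Suc k)
  then obtain w where w: "seq_thiele \<omega> C V R k = {w}" by (metis Suc_leD)
  then have "w \<in> seq_thiele \<omega> C V R k" by (metis singletonI)
  then have reach: "seq_reach \<omega> C V R w" and card: "card w = k"
    unfolding seq_thiele_def mem_Collect_eq by (metis)+
  have sub: "w \<subseteq> C" using reach by (rule seq_reach_subset)
  then have fin: "finite w" using assms(2) by (rule finite_subset)
  have "C - w \<noteq> {}"
  proof
    assume "C - w = {}"
    then have "w = C" using sub by (metis Diff_eq_empty_iff subset_antisym)
    then show False using Suc.prems card by (metis Suc_n_not_le_n)
  qed
  then obtain c where c: "selected \<omega> C V R w c"
    using selected_exists[OF assms(1,2)] by metis
  have uniq: "u = insert c w" if u: "seq_reach \<omega> C V R u" "card u = Suc k" for u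
    using u(1)
  proof (cases rule: seq_reach.cases)
    case empty
    then show ?thesis using u(2) by (metis card.empty nat.distinct(1))
  next
    case (insert w' d)
    have "finite w'" using seq_reach_subset[OF insert(2)] assms(2) by (rule finite_subset)
    moreover have "d \<notin> w'" using insert(3) unfolding selected_def by (metis DiffD2)
    ultimately have "card u = Suc (card w')" unfolding insert(1) by (rule card_insert_disjoint)
    then have "card w' = k" unfolding u(2) by (rule Suc_inject[symmetric])
    then have "w' \<in> seq_thiele \<omega> C V R k"
      unfolding seq_thiele_def by (intro CollectI conjI insert(2))
    then have "w' = w" using w by (metis singletonD)
    then show ?thesis using insert(1,3) c selected_unique[OF assms(1)] by metis
  qed
  have "c \<notin> w" using c unfolding selected_def by (metis DiffD2)
  then have "card (insert c w) = Suc k" using card fin by (metis card_insert_disjoint)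
  moreover have "seq_reach \<omega> C V R (insert c w)"
    using reach c by (rule seq_reach.insert)
  ultimately have "seq_thiele \<omega> C V R (Suc k) = {insert c w}"
    unfolding seq_thiele_def using uniq by (intro set_eqI) blast
  then show ?case by (rule exI)
qed


section \<open>Destructive control by deleting candidates\<close>

definition dcdc_solvable ::
  "'c rule \<Rightarrow> 'c set \<Rightarrow> 'c set multiset \<Rightarrow> 'c rel \<Rightarrow> nat \<Rightarrow> 'c set \<Rightarrow> nat \<Rightarrow> bool" where
  "dcdc_solvable \<psi> C V R k J l \<longleftrightarrow>
    (\<exists>C'. C' \<subseteq> C - J \<and> card C' \<le> l \<and> k \<le> card (C - C') \<and>
      (\<forall>w \<in> \<psi> (C - C') (restrict_votes (C - C') V) (Restr R (C - C')) k. w \<inter> J = {}))"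

text \<open>
  In an instance \<open>(cs, vs, k, js, l)\<close>, candidates are natural numbers, sets are given by
  repetition-free lists, and the tie-breaking order is the order in which the candidates are
  listed in \<open>cs\<close>, an earlier candidate being preferred.
\<close>

type_synonym dcdc_inst = "nat list \<times> nat list list \<times> nat \<times> nat list \<times> nat"

definition list_order :: "'c list \<Rightarrow> 'c rel" where
  "list_order cs = {(cs ! i, cs ! j) | i j. i \<le> j \<and> j < length cs}"

fun wf_inst :: "dcdc_inst \<Rightarrow> bool" where
  "wf_inst (cs, vs, k, js, l) \<longleftrightarrow>
    distinct cs \<and>
    (\<forall>v \<in> set vs. distinct v \<and> set v \<subseteq> set cs) \<and>
    distinct js \<and> js \<noteq> [] \<and> set js \<subseteq> set cs \<and>
    k \<le> length cs \<and> l \<le> length cs - k"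

fun enc_inst :: "dcdc_inst \<Rightarrow> data" where
  "enc_inst (cs, vs, k, js, l) =
    lst [lst (map num cs), lst (map (\<lambda>v. lst (map num v)) vs), num k, lst (map num js), num l]"

fun solvable_inst :: "nat rule \<Rightarrow> dcdc_inst \<Rightarrow> bool" where
  "solvable_inst \<psi> (cs, vs, k, js, l) \<longleftrightarrow>
    dcdc_solvable \<psi> (set cs) (mset (map set vs)) (list_order cs) k (set js) l"

fun remaining :: "dcdc_inst \<Rightarrow> nat" where
  "remaining (cs, vs, k, js, l) = card (set cs) - l"

fun distinguished :: "dcdc_inst \<Rightarrow> nat set" where
  "distinguished (cs, vs, k, js, l) = set js"

definition DCDC :: "nat rule \<Rightarrow> pproblem" where
  "DCDC \<psi> = {(enc_inst I, remaining I) | I. wf_inst I \<and> solvable_inst \<psi> I}"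

definition DCDC_single :: "nat rule \<Rightarrow> pproblem" where
  "DCDC_single \<psi> = {(enc_inst I, remaining I) | I.
    wf_inst I \<and> card (distinguished I) = 1 \<and> solvable_inst \<psi> I}"

lemma list_order_nth:
  assumes "distinct cs" "i < length cs" "j < length cs"
  shows "(cs ! i, cs ! j) \<in> list_order cs \<longleftrightarrow> i \<le> j"
  using assms by (auto simp: list_order_def nth_eq_iff_index_eq)

lemma linear_order_on_list_order:
  assumes d: "distinct cs"
  shows "linear_order_on (set cs) (list_order cs)"
  unfolding linear_order_on_def partial_order_on_def preorder_on_def
proof (intro conjI)
  show sub: "list_order cs \<subseteq> set cs \<times> set cs"
    by (auto simp: list_order_def)
  show "refl_on (set cs) (list_order cs)"
  proof (rule refl_onI)
    fix x assume "x \<in> set cs"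
    then show "(x, x) \<in> list_order cs"
      using list_order_nth[OF d] by (metis in_set_conv_nth order_refl)
  qed
  show "trans (list_order cs)"
  proof (rule transI)
    fix x y z assume xy: "(x, y) \<in> list_order cs" and yz: "(y, z) \<in> list_order cs"
    then obtain i j k where "x = cs ! i" "y = cs ! j" "z = cs ! k"
      "i < length cs" "j < length cs" "k < length cs"
      using sub by (metis in_set_conv_nth mem_Sigma_iff subsetD)
    then show "(x, z) \<in> list_order cs"
      using xy yz list_order_nth[OF d] by (metis le_trans)
  qed
  show "antisym (list_order cs)"
  proof (rule antisymI)
    fix x y assume xy: "(x, y) \<in> list_order cs" and yx: "(y, x) \<in> list_order cs"
    then obtain i j where "x = cs ! i" "y = cs ! j" "i < length cs" "j < length cs"
      using sub by (metis in_set_conv_nth mem_Sigma_iff subsetD)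
    then show "x = y"
      using xy yx list_order_nth[OF d] by (metis le_antisym)
  qed
  show "total_on (set cs) (list_order cs)"
  proof (rule total_onI)
    fix x y assume "x \<in> set cs" "y \<in> set cs"
    then show "(x, y) \<in> list_order cs \<or> (y, x) \<in> list_order cs"
      using list_order_nth[OF d] by (metis in_set_conv_nth nle_le)
  qed
qed

end

theory Submission
  imports Defs "HOL-Library.More_List"
begin

text \<open>
  Every problem in W[1] reduces to some p-WD problem for a formula that is preceded by universal
  quantifiers only; we reduce p-WD to independent set and independent set to DCDC, both in
  polynomial time.

  Order the \<open>N\<close> tuples that may belong to the relation \<open>X\<close>.  A \<open>k\<close>-element relation is a strictly
  increasing function from \<open>{0..k + 1}\<close> to \<open>{0..N + 1}\<close> that maps end points to end points.
  Any violation of the quantifier-free matrix is witnessed by boundedly many, say \<open>D\<close>, values of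
  this function, since a tuple is missing iff it lies strictly between two consecutive values.
  Hence solutions correspond to independent sets of size \<open>(k + 2)\<^sup>D\<close> in the graph whose vertices
  are the partial functions, listed by \<open>D\<close> argument-value pairs, that witness no violation, and
  whose edges join incompatible partial functions.

  For an independent set of size \<open>k\<close>, let the vertices and one distinguished candidate have equal
  approval scores, let each edge be a common vote, and let the distinguished candidate lose all
  ties.  Since \<open>\<omega> 2 < 2 * \<omega> 1\<close>, a vertex has a smaller margin than the distinguished
  candidate as soon as one of its neighbours is in the committee; so the distinguished candidate is
  avoided for \<open>k\<close> rounds iff the first \<open>k\<close> elected vertices are independent.
\<close>

section \<open>Polynomial-time functions\<close>

class encodable =
  fixes enc :: "'a \<Rightarrow> data"
  assumes enc_inject: "enc x = enc y \<Longrightarrow> x = y"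
begin

definition sz :: "'a \<Rightarrow> nat" where
  "sz x = len (enc x)"

lemma enc_eq_iff: "enc x = enc y \<longleftrightarrow> x = y"
  using enc_inject by blast

end

instantiation data :: encodable
begin
definition enc_data :: "data \<Rightarrow> data" where "enc_data x = x"
instance by standard (simp add: enc_data_def)
end

text \<open>The codes match the truth values of programs, so a program for a Boolean function can
  serve directly as the condition of \<open>PIf\<close> or \<open>PWhile\<close>.\<close>

instantiation bool :: encodable
begin
definition enc_bool :: "bool \<Rightarrow> data" where "enc_bool b = (if b then Node Atom Atom else Atom)"
instance by standard (auto simp: enc_bool_def split: if_splits)
end

lemma num_inject: "num m = num n \<Longrightarrow> m = n"
  by (induction m arbitrary: n; case_tac n) auto

instantiation nat :: encodable
begin
definition enc_nat :: "nat \<Rightarrow> data" where "enc_nat n = num n"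
instance by standard (auto simp: enc_nat_def dest: num_inject)
end

instantiation prod :: (encodable, encodable) encodable
begin
definition enc_prod :: "'a \<times> 'b \<Rightarrow> data" where "enc_prod z = Node (enc (fst z)) (enc (snd z))"
instance by standard (auto simp: enc_prod_def enc_eq_iff prod_eq_iff)
end

lemma lst_inject: "lst xs = lst ys \<Longrightarrow> xs = ys"
  by (induction xs arbitrary: ys; case_tac ys) auto

instantiation list :: (encodable) encodable
begin
definition enc_list :: "'a list \<Rightarrow> data" where "enc_list xs = lst (map enc xs)"
instance
proof
  fix xs ys :: "'a list"
  assume "enc xs = enc ys"
  then have "map enc xs = map enc ys" by (auto simp: enc_list_def dest: lst_inject)
  then show "xs = ys" by (metis enc_inject injI inj_map_eq_map)
qed
end

text \<open>A nonempty list has the same code as the pair of its head and tail, and the empty list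
  has the code of false; \<open>ptime_Cons\<close> and \<open>ptime_case_list\<close> rest on
  this.\<close>

lemma enc_list_simps [simp]:
  "enc [] = Atom" "enc (x # xs) = Node (enc x) (enc xs)"
  by (auto simp: enc_list_def)

lemma enc_Pair [simp]: "enc (x, y) = Node (enc x) (enc y)"
  by (simp add: enc_prod_def)

lemma enc_nat_simps [simp]: "enc (0::nat) = Atom" "enc (Suc n) = Node Atom (enc n)"
  by (auto simp: enc_nat_def)

lemma enc_bool_simps [simp]: "enc True = Node Atom Atom" "enc False = Atom"
  by (auto simp: enc_bool_def)

lemma enc_bool_eq_Atom [simp]: "enc (b::bool) = Atom \<longleftrightarrow> \<not> b"
  by (cases b) auto

lemma enc_data [simp]: "enc (d::data) = d"
  by (simp add: enc_data_def)

lemma sz_simps [simp]: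
  "sz ([]::'a::encodable list) = 1" "sz ((x::'a) # xs) = Suc (sz x + sz xs)"
  "sz (x, y::'b::encodable) = Suc (sz x + sz y)"
  "sz (n::nat) = Suc (2 * n)"
  by (induction n) (auto simp: sz_def)

lemma sz_bool: "sz (b::bool) \<le> 3"
  by (cases b) (auto simp: sz_def)

lemma len_pos [simp]: "0 < len d"
  by (cases d) auto

lemma sz_pos [simp]: "0 < sz x"
  by (simp add: sz_def)

lemma sz_append: "sz (xs @ ys) + 1 = sz xs + sz (ys::'a::encodable list)"
  by (induction xs) auto

lemma sz_mem: "x \<in> set xs \<Longrightarrow> sz x < sz xs"
  by (induction xs) auto

lemma length_less_sz: "length xs < sz xs"
  by (induction xs) auto

lemma sz_rev [simp]: "sz (rev xs) = sz (xs::'a::encodable list)"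
proof (induction xs)
  case (Cons x xs)
  then show ?case using sz_append[of "rev xs" "[x]"] by simp
qed simp

lemma sz_list_le:
  assumes "\<And>x. x \<in> set xs \<Longrightarrow> sz x \<le> b"
  shows "sz (xs::'a::encodable list) \<le> 1 + length xs * (1 + b)"
  using assms by (induction xs) fastforce+

section \<open>Polynomial bounds in the input size\<close>

definition polyb :: "('a::encodable \<Rightarrow> nat) \<Rightarrow> bool" where
  "polyb F \<longleftrightarrow> (\<exists>c. \<forall>x. F x \<le> (sz x + 2) ^ c)"

lemma polyb_mono: "polyb G \<Longrightarrow> (\<And>x. F x \<le> G x) \<Longrightarrow> polyb F"
  unfolding polyb_def by (meson le_trans)

lemma polyb_const [intro, simp]: "polyb (\<lambda>x. n)"
proof -
  have "n \<le> (sz x + 2) ^ n" for x :: 'a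
    by (rule order_trans[OF less_imp_le[OF less_exp]]) (simp add: power_mono)
  then show ?thesis unfolding polyb_def by blast
qed

lemma polyb_sz [intro, simp]: "polyb sz"
  unfolding polyb_def by (rule exI[of _ 1]) simp

lemma polyb_mult [intro]: "polyb F \<Longrightarrow> polyb G \<Longrightarrow> polyb (\<lambda>x. F x * G x)"
  unfolding polyb_def by (metis mult_le_mono power_add)

text \<open>The base \<open>sz x + 2\<close> is at least 2, so one more factor absorbs the sum; this
  is why \<open>polyb\<close> can do without coefficients.\<close>

lemma polyb_add [intro]:
  assumes "polyb F" "polyb G"
  shows "polyb (\<lambda>x. F x + G x)"
proof -
  obtain a b where ab: "\<And>x. F x \<le> (sz x + 2) ^ a" "\<And>x. G x \<le> (sz x + 2) ^ b"
    using assms unfolding polyb_def by blast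
  have "F x + G x \<le> (sz x + 2) ^ Suc (a + b)" for x
  proof -
    have "(sz x + 2) ^ a \<le> (sz x + 2) ^ (a + b)" "(sz x + 2) ^ b \<le> (sz x + 2) ^ (a + b)"
      by (simp_all add: power_increasing)
    then have "F x + G x \<le> 2 * (sz x + 2) ^ (a + b)"
      using ab[of x] by linarith
    also have "\<dots> \<le> (sz x + 2) * (sz x + 2) ^ (a + b)" by (rule mult_le_mono) auto
    finally show ?thesis by simp
  qed
  then show ?thesis unfolding polyb_def by blast
qed

lemma polyb_Suc [intro]: "polyb F \<Longrightarrow> polyb (\<lambda>x. Suc (F x))"
  using polyb_add[of F "\<lambda>x. 1"] by simp

lemma polyb_power [intro]: "polyb F \<Longrightarrow> polyb (\<lambda>x. F x ^ c)"
  by (induction c) auto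

section \<open>Functions computable in polynomial time\<close>

definition ptime :: "('a::encodable \<Rightarrow> 'b::encodable) \<Rightarrow> bool" where
  "ptime f \<longleftrightarrow> (\<exists>p T. polyb T \<and> (\<forall>x. exec p (enc x) (T x) (enc (f x))))"

text \<open>\<open>ptime\<close> asks for a function that gives the exact cost. Where only an upper
  bound is at hand, as after a case distinction, the exact costs are chosen pointwise.\<close>

lemma ptimeI_le:
  assumes "polyb B" "\<And>x. \<exists>t \<le> B x. exec p (enc x) t (enc (f x))"
  shows "ptime f"
proof -
  obtain T where "\<And>x. T x \<le> B x \<and> exec p (enc x) (T x) (enc (f x))"
    using assms(2) by metis
  then show ?thesis unfolding ptime_def using polyb_mono[OF assms(1)] by blast
qed

lemma ptimeI: "polyb T \<Longrightarrow> (\<And>x. exec p (enc x) (T x) (enc (f x))) \<Longrightarrow> ptime f"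
  unfolding ptime_def by blast

text \<open>The cost of a run bounds the size of its output, so every time bound is also a size
  bound.\<close>

lemma ptime_polyb_sz: "ptime f \<Longrightarrow> polyb (\<lambda>x. sz (f x))"
  unfolding ptime_def sz_def by (metis exec_output_len polyb_mono)

lemma polyb_comp:
  assumes "polyb F" "ptime f"
  shows "polyb (\<lambda>x. F (f x))"
proof -
  obtain c where c: "\<And>y. F y \<le> (sz y + 2) ^ c" using assms(1) unfolding polyb_def by blast
  have "polyb (\<lambda>x. (sz (f x) + 2) ^ c)"
    by (intro polyb_power polyb_add polyb_const ptime_polyb_sz assms(2))
  then show ?thesis by (rule polyb_mono) (rule c)
qed

named_theorems ptime_intros

lemma ptime_id [ptime_intros]: "ptime (\<lambda>x. x)"
  by (rule ptimeI[OF polyb_sz]) (auto simp: sz_def intro: exec.intros)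

lemma ptime_comp:
  assumes "ptime f" "ptime g"
  shows "ptime (\<lambda>x. f (g x))"
proof -
  obtain p T where f: "polyb T" "\<And>x. exec p (enc x) (T x) (enc (f x))"
    using assms(1) unfolding ptime_def by blast
  obtain q U where g: "polyb U" "\<And>x. exec q (enc x) (U x) (enc (g x))"
    using assms(2) unfolding ptime_def by blast
  show ?thesis
  proof (rule ptimeI)
    show "exec (PSeq q p) (enc x) (Suc (U x + T (g x))) (enc (f (g x)))" for x
      by (rule exec.Seq[OF g(2) f(2)])
    show "polyb (\<lambda>x. Suc (U x + T (g x)))"
      using g(1) polyb_comp[OF f(1) assms(2)] by auto
  qed
qed

text \<open>Programs see only trees. Coercions between types with equal codes, such as numbers and
  lists of atoms, therefore cost no new program.\<close>

lemma ptime_same_enc: "ptime f \<Longrightarrow> (\<And>x. enc (g x) = enc (f x)) \<Longrightarrow> ptime g"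
  unfolding ptime_def by simp

lemma ptime_Pair [ptime_intros]:
  assumes "ptime f" "ptime g"
  shows "ptime (\<lambda>x. (f x, g x))"
proof -
  obtain p T where f: "polyb T" "\<And>x. exec p (enc x) (T x) (enc (f x))"
    using assms(1) unfolding ptime_def by blast
  obtain q U where g: "polyb U" "\<And>x. exec q (enc x) (U x) (enc (g x))"
    using assms(2) unfolding ptime_def by blast
  show ?thesis
    by (rule ptimeI[where T = "\<lambda>x. Suc (T x + U x)" and p = "PPair p q"])
      (use f g in \<open>auto intro: exec.intros\<close>)
qed

lemma ptime_const [ptime_intros]: "ptime (\<lambda>x::'a::encodable. c)"
proof -
  have "\<exists>p T. polyb T \<and> (\<forall>x::'a. exec p (enc x) (T x) d)" for d
  proof (induction d)
    case Atom
    have "exec PAtom (enc x) (sz x) Atom" for x :: 'a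
      unfolding sz_def by (rule exec.Atom)
    then show ?case using polyb_sz by blast
  next
    case (Node d e)
    then obtain p q T U where "polyb T" "polyb U"
      "\<And>x::'a. exec p (enc x) (T x) d" "\<And>x::'a. exec q (enc x) (U x) e" by blast
    then have "polyb (\<lambda>x::'a. Suc (T x + U x))"
      "\<And>x::'a. exec (PPair p q) (enc x) (Suc (T x + U x)) (Node d e)"
      by (auto intro: exec.intros)
    then show ?case by blast
  qed
  then show ?thesis unfolding ptime_def by blast
qed

lemma ptime_fst [ptime_intros]:
  assumes "ptime f"
  shows "ptime (\<lambda>x. fst (f x :: 'b::encodable \<times> 'c::encodable))"
proof -
  have "exec PHead (enc z) (sz z) (enc (fst z))" for z :: "'b \<times> 'c"
    unfolding sz_def enc_prod_def by (rule exec.Head_Node)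
  then have "ptime (fst :: 'b \<times> 'c \<Rightarrow> _)" by (intro ptimeI[OF polyb_sz])
  then show ?thesis using ptime_comp assms by blast
qed

lemma ptime_snd [ptime_intros]:
  assumes "ptime f"
  shows "ptime (\<lambda>x. snd (f x :: 'b::encodable \<times> 'c::encodable))"
proof -
  have "exec PTail (enc z) (sz z) (enc (snd z))" for z :: "'b \<times> 'c"
    unfolding sz_def enc_prod_def by (rule exec.Tail_Node)
  then have "ptime (snd :: 'b \<times> 'c \<Rightarrow> _)" by (intro ptimeI[OF polyb_sz])
  then show ?thesis using ptime_comp assms by blast
qed

lemma ptime_If [ptime_intros]:
  assumes "ptime b" "ptime f" "ptime g"
  shows "ptime (\<lambda>x. if b x then f x else g x)"
proof -
  obtain r S where b: "polyb S" "\<And>x. exec r (enc x) (S x) (enc (b x))"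
    using assms(1) unfolding ptime_def by blast
  obtain p T where f: "polyb T" "\<And>x. exec p (enc x) (T x) (enc (f x))"
    using assms(2) unfolding ptime_def by blast
  obtain q U where g: "polyb U" "\<And>x. exec q (enc x) (U x) (enc (g x))"
    using assms(3) unfolding ptime_def by blast
  show ?thesis
  proof (rule ptimeI_le)
    show "polyb (\<lambda>x. Suc (S x + T x + U x))" by (intro polyb_Suc polyb_add b f g)
    fix x
    show "\<exists>t\<le>Suc (S x + T x + U x). exec (PIf r p q) (enc x) t (enc (if b x then f x else g x))"
    proof (cases "b x")
      case True
      then have "exec (PIf r p q) (enc x) (Suc (S x + T x)) (enc (f x))"
        using exec.If_True[OF b(2) _ f(2)] by simp
      then show ?thesis using True by (intro exI[of _ "Suc (S x + T x)"]) auto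
    next
      case False
      then have "exec (PIf r p q) (enc x) (Suc (S x + U x)) (enc (g x))"
        using exec.If_False[OF _ g(2), of r x "S x" p] b(2)[of x] by simp
      then show ?thesis using False by (intro exI[of _ "Suc (S x + U x)"]) auto
    qed
  qed
qed

lemma ptime_not [ptime_intros]: "ptime b \<Longrightarrow> ptime (\<lambda>x. \<not> b x)"
  by (rule ptime_same_enc[OF ptime_If[OF _ ptime_const[of False] ptime_const[of True], of b]]) auto

lemma ptime_conj [ptime_intros]: "ptime b \<Longrightarrow> ptime c \<Longrightarrow> ptime (\<lambda>x. b x \<and> c x)"
  by (rule ptime_same_enc[OF ptime_If[OF _ _ ptime_const[of False], of b c]]) auto

lemma ptime_disj [ptime_intros]: "ptime b \<Longrightarrow> ptime c \<Longrightarrow> ptime (\<lambda>x. b x \<or> c x)"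
  using ptime_not[OF ptime_conj[OF ptime_not ptime_not]] by simp

lemma ptime_case_list [ptime_intros]:
  fixes L :: "'a::encodable \<Rightarrow> 'b::encodable list"
  assumes "ptime L" "ptime f" "ptime (\<lambda>z. g (fst z) (fst (snd z)) (snd (snd z)))"
  shows "ptime (\<lambda>x. case L x of [] \<Rightarrow> f x | e # l \<Rightarrow> g x e l)"
proof -
  obtain r S where b: "polyb S" "\<And>x. exec r (enc x) (S x) (enc (L x))"
    using assms(1) unfolding ptime_def by blast
  obtain p T where f: "polyb T" "\<And>x. exec p (enc x) (T x) (enc (f x))"
    using assms(2) unfolding ptime_def by blast
  obtain q U where g: "polyb U"
    "\<And>z. exec q (enc z) (U z) (enc (g (fst z) (fst (snd z)) (snd (snd z))))"
    using assms(3) unfolding ptime_def by blast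
  obtain c where c: "\<And>z. U z \<le> (sz z + 2) ^ c" using g(1) unfolding polyb_def by blast
  have pS: "polyb (\<lambda>x. sz (L x))" using ptime_polyb_sz[OF assms(1)] .
  \<comment> \<open>Pairing the input with its nonempty list \<open>e # l\<close> already gives the
    code of \<open>(x, e, l)\<close>, the argument expected by \<open>q\<close>.\<close>
  define pq where "pq = PSeq (PPair PId r) q"
  define B where "B x = S x + T x + (sz x + S x + (sz x + sz (L x) + 3) ^ c) + 4" for x
  show ?thesis
  proof (rule ptimeI_le)
    show "polyb B" unfolding B_def
      by (intro polyb_add polyb_power b(1) f(1) pS polyb_sz polyb_const)
    fix x
    show "\<exists>t\<le>B x. exec (PIf r pq p) (enc x) t
        (enc (case L x of [] \<Rightarrow> f x | e # l \<Rightarrow> g x e l))"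
    proof (cases "L x")
      case Nil
      then have "exec (PIf r pq p) (enc x) (Suc (S x + T x)) (enc (f x))"
        using exec.If_False[OF _ f(2), of r x "S x" pq] b(2)[of x] by simp
      then show ?thesis using Nil by (intro exI[of _ "Suc (S x + T x)"]) (auto simp: B_def)
    next
      case (Cons e l)
      have "exec (PPair PId r) (enc x) (Suc (sz x + S x)) (enc (x, e, l))"
        using exec.Pair[OF exec.Id b(2)[of x]] Cons by (simp add: sz_def)
      then have "exec pq (enc x) (Suc (Suc (sz x + S x) + U (x, e, l))) (enc (g x e l))"
        unfolding pq_def using exec.Seq[OF _ g(2)[of "(x, e, l)"], of "PPair PId r" "enc x"] by fastforce
      then have "exec (PIf r pq p) (enc x) (Suc (S x + Suc (Suc (sz x + S x) + U (x, e, l))))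
          (enc (g x e l))"
        by (intro exec.If_True[OF b(2)]) (simp_all add: Cons)
      moreover have "U (x, e, l) \<le> (sz x + sz (L x) + 3) ^ c"
      proof -
        have "sz (x, e, l) + 2 = sz x + sz (L x) + 3" by (simp add: Cons)
        then show ?thesis using c[of "(x, e, l)"] by metis
      qed
      ultimately show ?thesis using Cons
        by (intro exI[of _ "Suc (S x + Suc (Suc (sz x + S x) + U (x, e, l)))"])
          (auto simp: B_def)
    qed
  qed
qed

text \<open>\<open>\<mu>\<close> bounds the number of rounds and \<open>G\<close> the size of every
  state, both polynomially in the original input, so each round is of polynomial cost too. The
  result is the entire final state.\<close>

lemma ptime_while:
  fixes step :: "'s::encodable \<Rightarrow> 's" and I :: "'a::encodable \<Rightarrow> 's \<Rightarrow> bool"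
  assumes "ptime init" "ptime test" "ptime step"
    and "polyb G" "polyb (\<lambda>x. \<mu> (init x))"
    and inv: "\<And>x. I x (init x)"
      "\<And>x s. I x s \<Longrightarrow> test s \<Longrightarrow> I x (step s)"
      "\<And>x s. I x s \<Longrightarrow> test s \<Longrightarrow> \<mu> (step s) < \<mu> s"
      "\<And>x s. I x s \<Longrightarrow> sz s \<le> G x"
      "\<And>x s. I x s \<Longrightarrow> \<not> test s \<Longrightarrow> s = r x"
  shows "ptime r"
proof -
  obtain b S where b: "polyb S" "\<And>x. exec b (enc x) (S x) (enc (test x))"
    using assms(2) unfolding ptime_def by blast
  obtain p T where p: "polyb T" "\<And>x. exec p (enc x) (T x) (enc (step x))"
    using assms(3) unfolding ptime_def by blast
  obtain i U where i: "polyb U" "\<And>x. exec i (enc x) (U x) (enc (init x))"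
    using assms(1) unfolding ptime_def by blast
  obtain cb cp where c: "\<And>s. S s \<le> (sz s + 2) ^ cb" "\<And>s. T s \<le> (sz s + 2) ^ cp"
    using b(1) p(1) unfolding polyb_def by blast
  define B where "B x = Suc ((G x + 2) ^ cb + (G x + 2) ^ cp)" for x
  have ST: "Suc (S s + T s) \<le> B x" if "I x s" for x s
  proof -
    have "sz s + 2 \<le> G x + 2" using inv(4) that by simp
    then show ?thesis using c power_mono unfolding B_def
      by (meson Suc_le_mono add_mono le_trans zero_le)
  qed
  \<comment> \<open>The summand from \<open>Suc\<close> pays for the last, failing test.\<close>
  have loop: "\<exists>t \<le> Suc (\<mu> s) * B x. exec (PWhile b p) (enc s) t (enc (r x))" if "I x s" for x s
    using that
  proof (induction "\<mu> s" arbitrary: s rule: less_induct)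
    case less
    show ?case
    proof (cases "test s")
      case True
      obtain t where t: "t \<le> Suc (\<mu> (step s)) * B x"
        "exec (PWhile b p) (enc (step s)) t (enc (r x))"
        using less.hyps[OF inv(3)[OF less.prems True] inv(2)[OF less.prems True]] by blast
      have "exec (PWhile b p) (enc s) (Suc (S s + T s + t)) (enc (r x))"
        by (rule exec.While_True[OF b(2) _ p(2) t(2)]) (simp add: True)
      moreover have "Suc (S s + T s + t) \<le> B x + Suc (\<mu> (step s)) * B x"
        using ST[OF less.prems] t(1) by simp
      moreover have "\<dots> \<le> Suc (\<mu> s) * B x"
        using inv(3)[OF less.prems True]
        by (metis Suc_leI Suc_le_mono mult_Suc mult_le_mono1)
      ultimately show ?thesis by (meson le_trans)
    next
      case False
      have "exec b (enc s) (S s) Atom" using b(2)[of s] False by simp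
      then have "exec (PWhile b p) (enc s) (Suc (S s)) (enc s)" by (rule exec.While_False)
      moreover have "s = r x" using inv(5) less.prems False .
      moreover have "Suc (S s) \<le> Suc (\<mu> s) * B x" using ST[OF less.prems] by simp
      ultimately show ?thesis by metis
    qed
  qed
  show ?thesis
  proof (rule ptimeI_le)
    show "polyb (\<lambda>x. Suc (U x + Suc (\<mu> (init x)) * B x))"
      unfolding B_def by (intro polyb_add polyb_Suc polyb_mult polyb_power polyb_const assms i(1))
    fix x
    obtain t where "t \<le> Suc (\<mu> (init x)) * B x" "exec (PWhile b p) (enc (init x)) t (enc (r x))"
      using loop inv(1) by blast
    then show "\<exists>t\<le>Suc (U x + Suc (\<mu> (init x)) * B x). exec (PSeq i (PWhile b p)) (enc x) t (enc (r x))"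
      using exec.Seq[OF i(2)[of x]] by (intro exI[of _ "Suc (U x + t)"]) auto
  qed
qed

text \<open>A polynomial-time step is not enough, since repeated growth of the accumulator may be
  exponential; hence the bound \<open>G\<close> on all partial results.\<close>

lemma ptime_fold:
  fixes f :: "'a::encodable \<Rightarrow> 'b::encodable \<Rightarrow> 'c::encodable \<Rightarrow> 'c"
  assumes "ptime L" "ptime a" "ptime (\<lambda>z. f (fst z) (fst (snd z)) (snd (snd z)))"
    and "polyb G"
    and G: "\<And>x pre suf. L x = pre @ suf \<Longrightarrow> sz (fold (f x) pre (a x)) \<le> G x"
  shows "ptime (\<lambda>x. fold (f x) (L x) (a x))"
proof -
  define step :: "'a \<times> 'b list \<times> 'c \<Rightarrow> 'a \<times> 'b list \<times> 'c" where
    "step = (\<lambda>s. case fst (snd s) of [] \<Rightarrow> s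
      | e # l \<Rightarrow> (fst s, l, f (fst s) e (snd (snd s))))"
  have pstep: "ptime step"
  proof -
    have eq: "(\<lambda>z. f (fst (fst z)) (fst (snd z)) (snd (snd (fst z)))) =
      (\<lambda>z. (\<lambda>z. f (fst z) (fst (snd z)) (snd (snd z))) (fst (fst z), fst (snd z), snd (snd (fst z))))"
      for z :: "('a \<times> 'b list \<times> 'c) \<times> 'b \<times> 'b list"
      by simp
    have "ptime (\<lambda>z :: ('a \<times> 'b list \<times> 'c) \<times> 'b \<times> 'b list.
        f (fst (fst z)) (fst (snd z)) (snd (snd (fst z))))"
      unfolding eq by (rule ptime_comp[OF assms(3)]) (intro ptime_intros)
    then show ?thesis unfolding step_def by (intro ptime_intros)
  qed
  have "ptime (\<lambda>x. (x, [] :: 'b list, fold (f x) (L x) (a x)))"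
  proof (rule ptime_while[where init = "\<lambda>x. (x, L x, a x)" and step = step
        and test = "\<lambda>s. case fst (snd s) of [] \<Rightarrow> False | _ \<Rightarrow> True"
        and \<mu> = "\<lambda>s. length (fst (snd s))" and G = "\<lambda>x. sz x + sz (L x) + G x + 2"
        and I = "\<lambda>x s. \<exists>pre suf. L x = pre @ suf \<and> s = (x, suf, fold (f x) pre (a x))"])
    show "ptime (\<lambda>x. (x, L x, a x))" by (intro ptime_intros assms)
    show "ptime (\<lambda>s::'a \<times> 'b list \<times> 'c. case fst (snd s) of [] \<Rightarrow> False | _ \<Rightarrow> True)"
      by (intro ptime_intros)
    show "ptime step" by (rule pstep)
    show "polyb (\<lambda>x. sz x + sz (L x) + G x + 2)"
      by (intro polyb_add polyb_sz assms polyb_const ptime_polyb_sz)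
    show "polyb (\<lambda>x. length (fst (snd (x, L x, a x))))"
      by (rule polyb_mono[OF ptime_polyb_sz[OF assms(1)]])
        (simp add: less_imp_le[OF length_less_sz])
  next
    fix x s
    assume I: "\<exists>pre suf. L x = pre @ suf \<and> s = (x, suf, fold (f x) pre (a x))"
    then obtain pre suf where s: "L x = pre @ suf" "s = (x, suf, fold (f x) pre (a x))" by blast
    show "sz s \<le> sz x + sz (L x) + G x + 2"
    proof -
      have "sz suf \<le> sz (L x)" using sz_append[of pre suf] sz_pos[of pre] unfolding s(1) by linarith
      then show ?thesis using G[OF s(1)] s(2) by simp
    qed
    show "s = (x, [], fold (f x) (L x) (a x))"
      if "\<not> (case fst (snd s) of [] \<Rightarrow> False | _ \<Rightarrow> True)"
      using that s by (cases suf) auto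
    show "\<exists>pre suf. L x = pre @ suf \<and> step s = (x, suf, fold (f x) pre (a x))"
      "length (fst (snd (step s))) < length (fst (snd s))"
      if test: "case fst (snd s) of [] \<Rightarrow> False | _ \<Rightarrow> True"
    proof -
      obtain e l where suf: "suf = e # l" using test s by (cases suf) auto
      then have "L x = (pre @ [e]) @ l \<and> step s = (x, l, fold (f x) (pre @ [e]) (a x))"
        using s by (simp add: step_def)
      then show "\<exists>pre suf. L x = pre @ suf \<and> step s = (x, suf, fold (f x) pre (a x))" by blast
      show "length (fst (snd (step s))) < length (fst (snd s))" using s suf by (simp add: step_def)
    qed
  qed auto
  from ptime_snd[OF ptime_snd[OF this]] show ?thesis by simp
qed

section \<open>List operations and bounded quantifiers\<close>

lemma ptime_Cons [ptime_intros]: "ptime f \<Longrightarrow> ptime L \<Longrightarrow> ptime (\<lambda>x. f x # L x)"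
  by (rule ptime_same_enc[OF ptime_Pair[of f L]]) auto

lemma ptime_rev [ptime_intros]:
  assumes "ptime L"
  shows "ptime (\<lambda>x. rev (L x))"
proof -
  have "ptime (\<lambda>x. fold (\<lambda>e l. e # l) (L x) [])"
  proof (rule ptime_fold[where G = "\<lambda>x. sz (L x)"])
    show "sz (fold (\<lambda>e l. e # l) pre []) \<le> sz (L x)" if "L x = pre @ suf" for x pre suf
      using sz_append[of pre suf] sz_pos[of suf] unfolding that rev_conv_fold[symmetric] sz_rev
      by linarith
  qed (intro ptime_intros assms ptime_polyb_sz)+
  then show ?thesis by (simp add: rev_conv_fold)
qed

lemma ptime_foldr:
  assumes "ptime L" "ptime a" "ptime (\<lambda>z. f (fst z) (fst (snd z)) (snd (snd z)))"
    and "polyb G"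
    and "\<And>x pre suf. L x = pre @ suf \<Longrightarrow> sz (foldr (f x) suf (a x)) \<le> G x"
  shows "ptime (\<lambda>x. foldr (f x) (L x) (a x))"
  unfolding foldr_conv_fold
proof (rule ptime_fold[OF ptime_rev[OF assms(1)] assms(2-4)])
  fix x pre suf assume "rev (L x) = pre @ suf"
  then have "L x = rev suf @ rev pre" by (metis rev_append rev_rev_ident)
  from assms(5)[OF this] show "sz (fold (f x) pre (a x)) \<le> G x" by (simp add: foldr_conv_fold)
qed

lemma ptime_append [ptime_intros]:
  assumes "ptime L" "ptime M"
  shows "ptime (\<lambda>x. L x @ M x)"
proof -
  have eq: "foldr (\<lambda>e l. e # l) xs ys = xs @ ys" for xs ys :: "'b list"
    by (induction xs) auto
  have "ptime (\<lambda>x. foldr (\<lambda>e l. e # l) (L x) (M x))"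
  proof (rule ptime_foldr[where G = "\<lambda>x. sz (L x) + sz (M x)"])
    show "sz (foldr (\<lambda>e l. e # l) suf (M x)) \<le> sz (L x) + sz (M x)" if "L x = pre @ suf" for x pre suf
      using sz_append[of pre suf] sz_pos[of pre] sz_append[of suf "M x"] unfolding eq that
      by linarith
  qed (intro ptime_intros assms ptime_polyb_sz polyb_add)+
  then show ?thesis unfolding eq .
qed

lemma ptime_concat [ptime_intros]:
  assumes "ptime L"
  shows "ptime (\<lambda>x. concat (L x))"
  unfolding concat_conv_foldr
proof (rule ptime_foldr[where G = "\<lambda>x. sz (L x)"])
  have le: "sz (foldr (@) xss []) \<le> sz (xss :: 'b list list)" for xss
  proof (induction xss)
    case (Cons xs xss)
    then show ?case using sz_append[of xs "foldr (@) xss []"] by simp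
  qed simp
  show "sz (foldr (@) suf []) \<le> sz (L x)" if "L x = pre @ suf" for x pre suf
    using le[of suf] sz_append[of pre suf] sz_pos[of pre] unfolding that by linarith
qed (intro ptime_intros assms ptime_polyb_sz)+

lemma ptime_map [ptime_intros]:
  fixes f :: "'a::encodable \<Rightarrow> 'b::encodable \<Rightarrow> 'c::encodable"
  assumes "ptime L" "ptime (\<lambda>z. f (fst z) (snd z))"
  shows "ptime (\<lambda>x. map (f x) (L x))"
proof -
  obtain c where c: "\<And>z. sz (f (fst z) (snd z)) \<le> (sz z + 2) ^ c"
    using ptime_polyb_sz[OF assms(2)] unfolding polyb_def by blast
  have eq: "foldr (\<lambda>e l. f x e # l) xs [] = map (f x) xs" for x xs
    by (induction xs) auto
  define G where "G x = 1 + sz (L x) * (1 + (sz x + sz (L x) + 3) ^ c)" for x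
  have "ptime (\<lambda>x. foldr (\<lambda>e l. f x e # l) (L x) [])"
  proof (rule ptime_foldr[where G = G])
    have eq2: "(\<lambda>z. f (fst z) (fst (snd z)) # snd (snd z)) =
        (\<lambda>z :: 'a \<times> 'b \<times> 'c list. (\<lambda>z. f (fst z) (snd z)) (fst z, fst (snd z)) # snd (snd z))"
      by simp
    show "ptime (\<lambda>z. f (fst z) (fst (snd z)) # snd (snd z))"
      unfolding eq2 by (intro ptime_Cons ptime_comp[OF assms(2)] ptime_intros)
    show "polyb G" unfolding G_def
      by (intro polyb_add polyb_mult polyb_power polyb_sz polyb_const ptime_polyb_sz assms)
    fix x pre suf
    assume L: "L x = pre @ suf"
    have "sz (map (f x) suf) \<le> 1 + length (map (f x) suf) * (1 + (sz x + sz (L x) + 3) ^ c)"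
    proof (rule sz_list_le)
      fix y assume "y \<in> set (map (f x) suf)"
      then obtain e where e: "e \<in> set (L x)" "y = f x e" using L by auto
      have "sz (x, e) + 2 \<le> sz x + sz (L x) + 3" using sz_mem[OF e(1)] by simp
      then show "sz y \<le> (sz x + sz (L x) + 3) ^ c"
        using c[of "(x, e)"] e(2) power_mono by (metis fst_conv le_trans snd_conv zero_le)
    qed
    also have "\<dots> \<le> G x"
      unfolding G_def using length_less_sz[of "L x"] L by (intro add_left_mono mult_le_mono1) simp
    finally show "sz (foldr (\<lambda>e l. f x e # l) suf []) \<le> G x" unfolding eq .
  qed (intro ptime_intros assms)+
  then show ?thesis unfolding eq .
qed

lemma ptime_filter [ptime_intros]:
  fixes P :: "'a::encodable \<Rightarrow> 'b::encodable \<Rightarrow> bool"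
  assumes "ptime L" "ptime (\<lambda>z. P (fst z) (snd z))"
  shows "ptime (\<lambda>x. filter (P x) (L x))"
proof -
  have "ptime (\<lambda>x. concat (map (\<lambda>e. if P x e then [e] else []) (L x)))"
    by (intro ptime_intros assms)
  moreover have "concat (map (\<lambda>e. if P x e then [e] else []) xs) = filter (P x) xs" for x xs
    by (induction xs) auto
  ultimately show ?thesis by simp
qed

lemma ptime_Bex [ptime_intros]:
  fixes P :: "'a::encodable \<Rightarrow> 'b::encodable \<Rightarrow> bool"
  assumes "ptime L" "ptime (\<lambda>z. P (fst z) (snd z))"
  shows "ptime (\<lambda>x. \<exists>e\<in>set (L x). P x e)"
proof -
  have "ptime (\<lambda>x. case filter (P x) (L x) of [] \<Rightarrow> False | e # l \<Rightarrow> True)"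
    by (intro ptime_intros assms)
  moreover have "(case filter (P x) xs of [] \<Rightarrow> False | e # l \<Rightarrow> True) \<longleftrightarrow> (\<exists>e\<in>set xs. P x e)" for x xs
    by (induction xs) auto
  ultimately show ?thesis by simp
qed

lemma ptime_Ball [ptime_intros]:
  assumes "ptime L" "ptime (\<lambda>z. P (fst z) (snd z))"
  shows "ptime (\<lambda>x. \<forall>e\<in>set (L x). P x e)"
proof -
  have "ptime (\<lambda>x. \<not> (\<exists>e\<in>set (L x). \<not> P x e))"
    by (intro ptime_not ptime_Bex assms)
  then show ?thesis by simp
qed

lemma ptime_imp [ptime_intros]: "ptime b \<Longrightarrow> ptime c \<Longrightarrow> ptime (\<lambda>x. b x \<longrightarrow> c x)"
  unfolding imp_conv_disj by (intro ptime_disj ptime_not)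

lemma ptime_lst [ptime_intros]: "ptime L \<Longrightarrow> ptime (\<lambda>x. lst (L x))"
  by (rule ptime_same_enc[of L]) (auto simp: enc_list_def enc_data_def[abs_def] o_def)

lemma ptime_enc [ptime_intros]: "ptime f \<Longrightarrow> ptime (\<lambda>x. enc (f x))"
  by (rule ptime_same_enc) auto

text \<open>Every tree is the code of a list of trees, read along its right branch. This coercion
  leaves the code unchanged and opens raw trees to the list operations.\<close>

primrec spine :: "data \<Rightarrow> data list" where
  "spine Atom = []"
| "spine (Node d e) = d # spine e"

lemma lst_spine [simp]: "lst (spine d) = d"
  by (induction d) auto

lemma enc_spine [simp]: "enc (spine d) = d"
  by (induction d) auto

lemma ptime_spine [ptime_intros]: "ptime f \<Longrightarrow> ptime (\<lambda>x. spine (f x))"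
  by (rule ptime_same_enc) auto

text \<open>Trees are compared with a stack of pairs of subtrees that remain to be compared.\<close>

definition eq_step :: "(data \<times> data) list \<times> bool \<Rightarrow> (data \<times> data) list \<times> bool" where
  "eq_step s = (case fst s of [] \<Rightarrow> s | e # l \<Rightarrow>
    (case spine (fst e) of
      [] \<Rightarrow> (case spine (snd e) of [] \<Rightarrow> (l, snd s) | _ # _ \<Rightarrow> ([], False))
    | a # as \<Rightarrow> (case spine (snd e) of [] \<Rightarrow> ([], False)
        | b # bs \<Rightarrow> ((a, b) # (lst as, lst bs) # l, snd s))))"

lemma ptime_eq_data: "ptime (\<lambda>z. fst z = (snd z :: data))"
proof -
  \<comment> \<open>The flag together with the pending comparisons decides the original equality; a
    failure empties the stack, which ends the loop.\<close>
  let ?I = "\<lambda>z s. (snd s \<and> (\<forall>e\<in>set (fst s). fst e = snd e) \<longleftrightarrow> fst z = snd z) \<and>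
    (snd s \<or> fst s = []) \<and> sz (fst s) \<le> sz z + 2"
  have "ptime (\<lambda>z. ([] :: (data \<times> data) list, fst z = (snd z :: data)))"
  proof (rule ptime_while[where I = ?I and init = "\<lambda>z. ([z], True)" and step = eq_step
        and test = "\<lambda>s. case fst s of [] \<Rightarrow> False | _ # _ \<Rightarrow> True"
        and \<mu> = "\<lambda>s. sum_list (map (sz \<circ> fst) (fst s))" and G = "\<lambda>z. sz z + 6"])
    show "ptime (\<lambda>z::data \<times> data. ([z], True))" by (intro ptime_intros)
    show "ptime (\<lambda>s::(data \<times> data) list \<times> bool. case fst s of [] \<Rightarrow> False | _ # _ \<Rightarrow> True)"
      by (intro ptime_intros)
    show "ptime eq_step" unfolding eq_step_def[abs_def] by (intro ptime_intros)
    show "polyb (\<lambda>x :: data \<times> data. sz x + 6)" by (intro polyb_add polyb_sz polyb_const)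
    show "polyb (\<lambda>x :: data \<times> data. sum_list (map (sz \<circ> fst) (fst ([x], True))))"
      by (rule polyb_mono[OF polyb_sz]) (auto simp: sz_def enc_prod_def)
    show "?I z ([z], True)" for z by (cases z) auto
  next
    fix z :: "data \<times> data" and s :: "(data \<times> data) list \<times> bool"
    assume I: "?I z s"
    show "sz s \<le> sz z + 6" using I sz_bool[of "snd s"] by (cases s) auto
    show "s = ([], fst z = snd z)" if "\<not> (case fst s of [] \<Rightarrow> False | _ # _ \<Rightarrow> True)"
      using that I by (cases s) (auto split: list.splits)
    assume t: "case fst s of [] \<Rightarrow> False | _ # _ \<Rightarrow> True"
    obtain d e l f where s: "s = ((d, e) # l, f)"
      using t by (cases s) (auto split: list.splits)
    have szN: "sz (Node a b) = Suc (sz a + sz b)" for a b by (simp add: sz_def)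
    \<comment> \<open>Opening a pair of nodes preserves the size of the stack: the two vanished
      nodes pay for one more pair and one more list cell.\<close>
    show "?I z (eq_step s)" using I szN unfolding s
      by (cases d; cases e) (auto simp: eq_step_def)
    \<comment> \<open>Measuring left components suffices: opening a node replaces its size by the
      sizes of its two subtrees, which is one less.\<close>
    show "sum_list (map (sz \<circ> fst) (fst (eq_step s))) < sum_list (map (sz \<circ> fst) (fst s))"
      using szN unfolding s by (cases d; cases e) (auto simp: eq_step_def)
  qed
  from ptime_snd[OF this] show ?thesis by simp
qed

lemma ptime_eq [ptime_intros]:
  assumes "ptime f" "ptime g"
  shows "ptime (\<lambda>x. f x = g x)"
  using ptime_comp[OF ptime_eq_data, of "\<lambda>x. (enc (f x), enc (g x))"] assms
  by (simp add: enc_eq_iff ptime_Pair ptime_enc)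

section \<open>Arithmetic on unary numbers, indexed lists\<close>

lemma ptime_Suc [ptime_intros]: "ptime N \<Longrightarrow> ptime (\<lambda>x. Suc (N x))"
  by (rule ptime_same_enc[OF ptime_Pair[of "\<lambda>x. Atom" N]]) (auto intro: ptime_const)

text \<open>Numbers are unary, so a number has the code of a list of that many atoms, and loops over
  lists serve as loops over numbers.\<close>

lemma enc_replicate_Atom [simp]: "enc (replicate n Atom) = enc n"
  by (induction n) auto

lemma ptime_replicate_Atom [ptime_intros]: "ptime N \<Longrightarrow> ptime (\<lambda>x. replicate (N x) Atom)"
  by (rule ptime_same_enc) auto

lemma ptime_replicate [ptime_intros]:
  assumes "ptime N" "ptime f"
  shows "ptime (\<lambda>x. replicate (N x) (f x))"
proof -
  have "ptime (\<lambda>x. map (\<lambda>_. f x) (replicate (N x) Atom))"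
    by (intro ptime_map ptime_replicate_Atom ptime_comp[OF assms(2)] ptime_intros assms)
  then show ?thesis by simp
qed

lemma ptime_length [ptime_intros]:
  assumes "ptime L"
  shows "ptime (\<lambda>x. length (L x))"
proof -
  have "ptime (\<lambda>x. map (\<lambda>_. Atom) (L x))" by (intro ptime_intros assms)
  then show ?thesis by (rule ptime_same_enc) (simp add: map_replicate_const)
qed

lemma ptime_add [ptime_intros]:
  assumes "ptime M" "ptime N"
  shows "ptime (\<lambda>x. M x + N x :: nat)"
proof -
  have "ptime (\<lambda>x. length (replicate (M x) Atom @ replicate (N x) Atom))"
    by (intro ptime_intros assms)
  then show ?thesis by simp
qed

lemma ptime_mult [ptime_intros]:
  assumes "ptime M" "ptime N"
  shows "ptime (\<lambda>x. M x * N x :: nat)"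
proof -
  have "ptime (\<lambda>x. length (concat (replicate (M x) (replicate (N x) Atom))))"
    by (intro ptime_intros assms)
  then show ?thesis by (simp add: length_concat sum_list_replicate)
qed

lemma ptime_power [ptime_intros]: "ptime N \<Longrightarrow> ptime (\<lambda>x. N x ^ c :: nat)"
  by (induction c) (simp_all add: ptime_const ptime_mult)

lemma ptime_upt [ptime_intros]:
  assumes "ptime N"
  shows "ptime (\<lambda>x. [0..<N x])"
proof -
  \<comment> \<open>The list only counts rounds; the length of the accumulator is the next number to
    append.\<close>
  have eq: "fold (\<lambda>_ l. l @ [length l]) xs [] = [0..<length xs]" for xs :: "data list"
    by (induction xs rule: rev_induct) auto
  have "ptime (\<lambda>x. fold (\<lambda>_ l. l @ [length l]) (replicate (N x) Atom) [])"
  proof (rule ptime_fold[where G = "\<lambda>x. 1 + N x * (1 + (1 + 2 * N x))"])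
    show "polyb (\<lambda>x. 1 + N x * (1 + (1 + 2 * N x)))"
      by (intro polyb_add polyb_mult polyb_const; rule polyb_mono[OF ptime_polyb_sz[OF assms]]; simp)
    fix x and pre suf :: "data list"
    assume pre: "replicate (N x) Atom = pre @ suf"
    have le: "length pre \<le> N x" using arg_cong[OF pre, of length] by simp
    have "sz [0..<length pre] \<le> 1 + length [0..<length pre] * (1 + (1 + 2 * N x))"
      using le by (intro sz_list_le) auto
    also have "\<dots> \<le> 1 + N x * (1 + (1 + 2 * N x))"
      using le by (intro add_left_mono mult_le_mono1) simp
    finally show "sz (fold (\<lambda>_ l. l @ [length l]) pre []) \<le> 1 + N x * (1 + (1 + 2 * N x))"
      unfolding eq .
  qed (intro ptime_intros assms)+
  then show ?thesis unfolding eq by simp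
qed

lemma ptime_less [ptime_intros]:
  assumes "ptime M" "ptime N"
  shows "ptime (\<lambda>x. M x < (N x :: nat))"
proof -
  have "ptime (\<lambda>x. \<exists>i\<in>set [0..<N x]. i = M x)"
    by (intro ptime_Bex ptime_upt ptime_eq ptime_comp[OF assms(1)] ptime_intros assms)
  then show ?thesis by simp
qed

lemma ptime_diff [ptime_intros]:
  assumes "ptime M" "ptime N"
  shows "ptime (\<lambda>x. M x - (N x :: nat))"
proof -
  have "ptime (\<lambda>x. length (filter (\<lambda>i. \<not> i < N x) [0..<M x]))"
    by (intro ptime_length ptime_filter ptime_not ptime_less ptime_upt ptime_comp[OF assms(2)]
        ptime_intros assms)
  moreover have "length (filter (\<lambda>i. \<not> i < n) [0..<m]) = m - n" for m n :: nat
    by (induction m) auto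
  ultimately show ?thesis by simp
qed

lemma ptime_enumerate [ptime_intros]:
  assumes "ptime L"
  shows "ptime (\<lambda>x. enumerate 0 (L x))"
proof -
  have eq: "fold (\<lambda>e l. l @ [(length l, e)]) xs [] = enumerate 0 xs" for xs :: "'b list"
    by (induction xs rule: rev_induct) (auto simp: enumerate_append_eq)
  let ?G = "\<lambda>x. 1 + sz (L x) * (1 + (2 + 2 * sz (L x) + sz (L x)))"
  have "ptime (\<lambda>x. fold (\<lambda>e l. l @ [(length l, e)]) (L x) [])"
  proof (rule ptime_fold[where G = ?G])
    show "polyb ?G"
      by (intro polyb_add polyb_mult polyb_const ptime_polyb_sz assms)
    fix x pre suf
    assume L: "L x = pre @ suf"
    have le: "length pre \<le> sz (L x)" using length_less_sz[of "L x"] L by simp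
    have "sz (enumerate 0 pre) \<le>
        1 + length (enumerate 0 pre) * (1 + (2 + 2 * sz (L x) + sz (L x)))"
    proof (rule sz_list_le)
      fix p assume mem: "p \<in> set (enumerate 0 pre)"
      obtain i e where p: "p = (i, e)" by (cases p)
      have "i < length pre" "e \<in> set (L x)"
        using mem unfolding L p by (auto simp: in_set_enumerate_eq)
      then show "sz p \<le> 2 + 2 * sz (L x) + sz (L x)" using le sz_mem[of e "L x"] p by simp
    qed
    also have "\<dots> \<le> ?G x" using le by (intro add_left_mono mult_le_mono1) simp
    finally show "sz (fold (\<lambda>e l. l @ [(length l, e)]) pre []) \<le> ?G x" unfolding eq .
  qed (intro ptime_intros assms)+
  then show ?thesis unfolding eq .
qed

lemma ptime_distinct [ptime_intros]:
  assumes "ptime L"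
  shows "ptime (\<lambda>x. distinct (L x))"
proof -
  have "distinct xs \<longleftrightarrow> (\<forall>p\<in>set (enumerate 0 xs). \<forall>q\<in>set (enumerate 0 xs).
      snd p = snd q \<longrightarrow> fst p = fst q)" for xs :: "'b list"
    by (force simp: distinct_conv_nth in_set_enumerate_eq Ball_def)
  moreover have "ptime (\<lambda>x. \<forall>p\<in>set (enumerate 0 (L x)). \<forall>q\<in>set (enumerate 0 (L x)).
      snd p = snd q \<longrightarrow> fst p = fst q)"
    by (intro ptime_Ball ptime_enumerate ptime_comp[OF assms] ptime_intros assms)
  ultimately show ?thesis by simp
qed

text \<open>The length \<open>n\<close> is fixed, so it becomes an exponent that does not depend on
  the input; it will be determined by the formula alone.\<close>

lemma ptime_n_lists [ptime_intros]:
  assumes "ptime L"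
  shows "ptime (\<lambda>x. List.n_lists n (L x))"
proof (induction n)
  case (Suc n)
  show ?case unfolding List.n_lists.simps
    by (intro ptime_concat ptime_map Suc ptime_comp[OF assms] ptime_intros)
qed (simp add: ptime_const)

text \<open>The index is fixed, and the default gives a definite value outside the list, where
  \<open>!\<close> is unspecified.\<close>

lemma ptime_nth_default [ptime_intros]:
  assumes "ptime L"
  shows "ptime (\<lambda>x. nth_default d (L x) n)"
  using assms
proof (induction n arbitrary: L)
  case 0
  have "ptime (\<lambda>x. case L x of [] \<Rightarrow> d | e # _ \<Rightarrow> e)" by (intro ptime_intros 0)
  moreover have "nth_default d xs 0 = (case xs of [] \<Rightarrow> d | e # _ \<Rightarrow> e)" for xs
    by (cases xs) auto
  ultimately show ?case by simp
next
  case (Suc n)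
  have "ptime (\<lambda>x. case L x of [] \<Rightarrow> [] | _ # l \<Rightarrow> l)" by (intro ptime_intros Suc.prems)
  from Suc.IH[OF this] have "ptime (\<lambda>x. nth_default d (case L x of [] \<Rightarrow> [] | _ # l \<Rightarrow> l) n)" .
  moreover have "nth_default d xs (Suc n) = nth_default d (case xs of [] \<Rightarrow> [] | _ # l \<Rightarrow> l) n" for xs
    by (cases xs) auto
  ultimately show ?case by simp
qed

section \<open>From independent set to deleting candidates\<close>

lemma score_restrict_votes: "w \<subseteq> X \<Longrightarrow> score \<omega> (restrict_votes X V) w = score \<omega> V w"
  unfolding score_def restrict_votes_def
  by (simp add: image_mset.compositionality o_def Int_assoc Int_absorb1)

text \<open>Committees of remaining candidates meet a vote only in remaining candidates, so all
  margins can be computed in the full election.\<close>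

lemma margin_restrict_votes:
  "w \<subseteq> X \<Longrightarrow> c \<in> X \<Longrightarrow> margin \<omega> (restrict_votes X V) w c = margin \<omega> V w c"
  unfolding margin_def by (simp add: score_restrict_votes)

lemma score_mset: "score \<omega> (mset (map set vs)) w = (\<Sum>v\<leftarrow>vs. \<omega> (card (set v \<inter> w)))"
  unfolding score_def mset_map[symmetric] sum_mset_sum_list by (simp add: o_def)

lemma linear_order_on_subset:
  "linear_order_on A R \<Longrightarrow> X \<subseteq> A \<Longrightarrow> linear_order_on X (Restr R X)"
  by (auto simp: order_on_defs refl_on_def trans_def antisym_def total_on_def) blast+

text \<open>
  The candidates \<open>0, \<dots>, q - 1\<close> are the vertices of a graph and \<open>q\<close> is the distinguished
  candidate.  Every candidate is approved by exactly \<open>2 * q\<close> votes, a pair of vertices shares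
  a vote iff it is an edge, and the distinguished candidate loses all ties.
\<close>

definition pair_votes :: "(nat \<Rightarrow> nat \<Rightarrow> bool) \<Rightarrow> nat \<Rightarrow> nat \<Rightarrow> nat list list" where
  "pair_votes adj i j = (if adj i j then [[i, j]] else [[i], [j]])"

definition graph_votes :: "nat \<Rightarrow> (nat \<Rightarrow> nat \<Rightarrow> bool) \<Rightarrow> nat list list" where
  "graph_votes q adj =
    concat (map (\<lambda>i. concat (map (pair_votes adj i) [0..<q])) [0..<q]) @ replicate (2 * q) [q]"

text \<open>The distinguished candidate cannot be deleted; using up the budget \<open>q - k\<close>
  leaves it together with exactly \<open>k\<close> vertices, so the parameter is
  \<open>k + 1\<close>.\<close>

definition graph_inst :: "nat \<Rightarrow> (nat \<Rightarrow> nat \<Rightarrow> bool) \<Rightarrow> nat \<Rightarrow> dcdc_inst" where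
  "graph_inst q adj k = ([0..<Suc q], graph_votes q adj, k, [q], q - k)"

lemma wf_graph_inst:
  assumes "\<And>i. \<not> adj i i" "k \<le> q"
  shows "wf_inst (graph_inst q adj k)"
  using assms by (auto simp: graph_inst_def graph_votes_def pair_votes_def split: if_splits)

lemma remaining_graph_inst: "k \<le> q \<Longrightarrow> remaining (graph_inst q adj k) = Suc k"
  by (simp add: graph_inst_def)

section \<open>Margins in the election of a graph\<close>

definition independent :: "('a \<Rightarrow> 'a \<Rightarrow> bool) \<Rightarrow> 'a set \<Rightarrow> bool" where
  "independent adj W \<longleftrightarrow> (\<forall>i\<in>W. \<forall>j\<in>W. \<not> adj i j)"

text \<open>\<open>irrefl\<close> ensures that the common vote of an edge contains two different
  candidates. Ordered pairs are treated one by one, so \<open>adj\<close> may be asymmetric.\<close>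

locale graph_election =
  fixes \<omega> :: "nat \<Rightarrow> real" and q :: nat and adj :: "nat \<Rightarrow> nat \<Rightarrow> bool"
  assumes thiele: "is_thiele \<omega>" and concave: "\<omega> 2 < 2 * \<omega> 1"
    and irrefl: "\<And>i. \<not> adj i i"
begin

definition votes :: "nat set multiset" where
  "votes = mset (map set (graph_votes q adj))"

definition pair_score :: "nat set \<Rightarrow> nat \<Rightarrow> nat \<Rightarrow> real" where
  "pair_score w i j = (if adj i j then \<omega> (card ({i, j} \<inter> w))
     else \<omega> (card ({i} \<inter> w)) + \<omega> (card ({j} \<inter> w)))"

lemma \<omega>_0: "\<omega> 0 = 0"
  using thiele by (simp add: is_thiele_def)

lemma score_votes:
  "score \<omega> votes w = (\<Sum>i<q. \<Sum>j<q. pair_score w i j) + 2 * q * \<omega> (card ({q} \<inter> w))"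
proof -
  have "(\<Sum>v\<leftarrow>pair_votes adj i j. \<omega> (card (set v \<inter> w))) = pair_score w i j" for i j
    by (simp add: pair_votes_def pair_score_def)
  moreover have concat: "(\<Sum>x\<leftarrow>concat xss. f x) = (\<Sum>xs\<leftarrow>xss. \<Sum>x\<leftarrow>xs. f x)" for f :: "'b \<Rightarrow> real" and xss
    by (induction xss) auto
  ultimately show ?thesis
    unfolding votes_def score_mset graph_votes_def
    by (simp add: concat o_def sum_list_replicate map_replicate
        interv_sum_list_conv_sum_set_nat atLeast0LessThan)
qed

text \<open>These are the ordered pairs with a common vote in which \<open>c\<close> would be the
  second elected candidate, adding only \<open>\<omega> 2 - \<omega> 1\<close>.\<close>

definition touches :: "nat set \<Rightarrow> nat \<Rightarrow> nat \<Rightarrow> nat \<Rightarrow> bool" where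
  "touches w c i j \<longleftrightarrow> adj i j \<and> (i = c \<and> j \<in> w \<or> j = c \<and> i \<in> w)"

text \<open>Each occurrence of \<open>c\<close> in the pair is worth \<open>\<omega> 1\<close>,
  except in a common vote whose other candidate is already elected; there the gain falls short by
  \<open>2 * \<omega> 1 - \<omega> 2\<close>.\<close>

lemma pair_score_insert:
  assumes "c \<notin> w"
  shows "pair_score (insert c w) i j - pair_score w i j =
    (of_bool (i = c) + of_bool (j = c)) * \<omega> 1 - (2 * \<omega> 1 - \<omega> 2) * of_bool (touches w c i j)"
proof -
  have "card {i, j} = 2" if "i \<noteq> j" using that by simp
  moreover have "i \<noteq> j" if "adj i j" using that irrefl by blast
  ultimately show ?thesis
    using assms by (auto simp: pair_score_def touches_def \<omega>_0 numeral_2_eq_2)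
qed

text \<open>The first term counts the occurrences of \<open>c\<close> in all ordered pairs, the
  second collects the losses from elected neighbours.\<close>

lemma margin_vertex:
  assumes "w \<subseteq> {..<q}" "c < q" "c \<notin> w"
  shows "margin \<omega> votes w c =
    2 * q * \<omega> 1 - (2 * \<omega> 1 - \<omega> 2) * (\<Sum>i<q. \<Sum>j<q. of_bool (touches w c i j))"
proof -
  have q: "{q} \<inter> insert c w = {}" "{q} \<inter> w = {}" using assms by auto
  have "margin \<omega> votes w c = (\<Sum>i<q. \<Sum>j<q. pair_score (insert c w) i j - pair_score w i j)"
    by (simp add: margin_def score_votes q sum_subtractf)
  also have "\<dots> = (\<Sum>i<q. \<Sum>j<q. (of_bool (i = c) + of_bool (j = c)) * \<omega> 1) -
      (2 * \<omega> 1 - \<omega> 2) * (\<Sum>i<q. \<Sum>j<q. of_bool (touches w c i j))"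
    unfolding pair_score_insert[OF assms(3)] sum_subtractf sum_distrib_left ..
  \<comment> \<open>The row \<open>i = c\<close> and the column \<open>j = c\<close> contribute
    \<open>q\<close> each, the diagonal pair being counted in both.\<close>
  also have "(\<Sum>i<q. \<Sum>j<q. (of_bool (i = c) + of_bool (j = c)) * \<omega> 1) = 2 * q * \<omega> 1"
  proof -
    have "(\<Sum>i<q. \<Sum>j<q. of_bool (i = c) + of_bool (j = c) :: real) = 2 * q"
      using assms(2) by (simp add: sum.distrib of_bool_def sum.delta sum_distrib_left[symmetric])
    then show ?thesis by (simp add: sum_distrib_right[symmetric])
  qed
  finally show ?thesis .
qed

text \<open>By \<open>concave\<close> every loss is strictly positive, so the upper bound is
  attained only if there is no loss at all.\<close>

lemma margin_vertex_le:
  assumes "w \<subseteq> {..<q}" "c < q" "c \<notin> w"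
  shows "margin \<omega> votes w c \<le> 2 * q * \<omega> 1"
    and "margin \<omega> votes w c = 2 * q * \<omega> 1 \<longleftrightarrow> (\<forall>d\<in>w. \<not> adj c d \<and> \<not> adj d c)"
proof -
  define E :: real where "E = (\<Sum>i<q. \<Sum>j<q. of_bool (touches w c i j))"
  have "E \<ge> 0" unfolding E_def by (intro sum_nonneg) auto
  then have "(2 * \<omega> 1 - \<omega> 2) * E \<ge> 0" using concave by simp
  then show "margin \<omega> votes w c \<le> 2 * q * \<omega> 1"
    unfolding margin_vertex[OF assms] E_def[symmetric] by linarith
  have "margin \<omega> votes w c = 2 * q * \<omega> 1 \<longleftrightarrow> E = 0"
    unfolding margin_vertex[OF assms] E_def[symmetric] using concave by simp
  also have "\<dots> \<longleftrightarrow> (\<forall>i<q. \<forall>j<q. \<not> touches w c i j)"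
    unfolding E_def by (auto simp: sum_nonneg_eq_0_iff sum_nonneg simp del: sum_of_bool_eq)
  also have "\<dots> \<longleftrightarrow> (\<forall>d\<in>w. \<not> adj c d \<and> \<not> adj d c)"
    using assms by (auto simp: touches_def)
  finally show "margin \<omega> votes w c = 2 * q * \<omega> 1 \<longleftrightarrow> (\<forall>d\<in>w. \<not> adj c d \<and> \<not> adj d c)" .
qed

text \<open>Only the singleton votes contain \<open>q\<close>, so its margin always equals the best
  value that a vertex can reach.\<close>

lemma margin_distinguished:
  assumes "w \<subseteq> {..<q}"
  shows "margin \<omega> votes w q = 2 * q * \<omega> 1"
proof -
  have "pair_score (insert q w) i j = pair_score w i j" if "i < q" "j < q" for i j
    using that by (simp add: pair_score_def)
  moreover have "q \<notin> w" using assms by auto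
  ultimately show ?thesis by (simp add: margin_def score_votes \<omega>_0)
qed

text \<open>The candidate \<open>q\<close> competes in every round with the maximum possible margin.
  A vertex elected instead attains this maximum too, so none of its neighbours was elected
  before.\<close>

lemma seq_reach_independent:
  assumes "X \<subseteq> {..q}" "q \<in> X"
    and "seq_reach \<omega> X (restrict_votes X votes) R w" "q \<notin> w"
  shows "independent adj w"
  using assms(3,4)
proof (induction rule: seq_reach.induct)
  case empty
  show ?case by (simp add: independent_def)
next
  case (insert w c)
  let ?V = "restrict_votes X votes"
  have w: "w \<subseteq> X" "q \<notin> w" and c: "c \<in> X" "c \<notin> w" "c \<noteq> q"
    using seq_reach_subset[OF insert.hyps(1)] insert.hyps(2) insert.prems
    by (auto simp: selected_def)
  have "w \<subseteq> {..q}" "c \<le> q" using w(1) c(1) assms(1) by auto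
  then have wq: "w \<subseteq> {..<q}" and cq: "c < q" using w(2) c(3) by (auto simp: le_less)
  have "margin \<omega> ?V w q \<le> margin \<omega> ?V w c"
    using insert.hyps(2) assms(2) w(2) unfolding selected_def
    by (metis DiffI eq_refl less_imp_le)
  then have "2 * q * \<omega> 1 \<le> margin \<omega> votes w c"
    using w wq c assms(2) by (simp add: margin_restrict_votes margin_distinguished)
  then have "\<forall>d\<in>w. \<not> adj c d \<and> \<not> adj d c"
    using margin_vertex_le[OF wq cq c(2)] by simp
  then show ?case
    using insert.IH w(2) irrefl by (auto simp: independent_def)
qed

text \<open>As long as some vertex of \<open>W\<close> is not elected, it has the same margin as
  \<open>q\<close> and precedes \<open>q\<close> in the order.\<close>

lemma independent_seq_reach:
  assumes W: "W \<subseteq> {..<q}" "independent adj W"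
    and "seq_reach \<omega> (insert q W) (restrict_votes (insert q W) votes)
      (Restr (list_order [0..<Suc q]) (insert q W)) w"
    and "card w \<le> card W"
  shows "q \<notin> w"
  using assms(3,4)
proof (induction rule: seq_reach.induct)
  case (insert w c)
  let ?X = "insert q W"
  let ?V = "restrict_votes ?X votes"
  have finW: "finite W" using W(1) finite_subset by blast
  have wX: "w \<subseteq> ?X" using seq_reach_subset[OF insert.hyps(1)] .
  then have "finite w" using finW finite_subset by blast
  moreover have c: "c \<in> ?X - w" using insert.hyps(2) by (simp add: selected_def)
  ultimately have lt: "card w < card W" using insert.prems by simp
  then have "q \<notin> w" using insert.IH by simp
  then have w: "w \<subseteq> W" "w \<subseteq> {..<q}" using wX W(1) by auto
  have "c \<noteq> q"
  proof
    assume "c = q"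
    \<comment> \<open>Fewer than \<open>card W\<close> candidates are elected so far, which leaves a
      vertex to beat \<open>q\<close>.\<close>
    obtain d where d: "d \<in> W" "d \<notin> w"
      using lt \<open>finite w\<close> card_mono[of w W] by (metis not_less subsetI)
    then have "d < q" using W(1) by auto
    then have "(q, d) \<notin> list_order [0..<Suc q]"
      using list_order_nth[of "[0..<Suc q]" q d] by (simp del: upt_Suc)
    moreover have "margin \<omega> votes w d = 2 * q * \<omega> 1"
      using margin_vertex_le(2)[OF w(2) \<open>d < q\<close> d(2)] W(2) w(1) d(1)
      by (auto simp: independent_def)
    then have "margin \<omega> ?V w d = margin \<omega> ?V w q"
      using w d margin_distinguished[OF w(2)] by (simp add: margin_restrict_votes subset_insertI2)
    ultimately show False
      using insert.hyps(2) d unfolding \<open>c = q\<close> selected_def by (metis DiffI IntD1 insertI2 less_irrefl)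
  qed
  then show ?case using \<open>q \<notin> w\<close> by simp
qed simp

text \<open>The winning committee after a successful deletion is the independent set; conversely,
  all vertices outside a given independent set are deleted.\<close>

theorem solvable_graph_inst:
  assumes "k \<le> q"
  shows "solvable_inst (seq_thiele \<omega>) (graph_inst q adj k) \<longleftrightarrow>
    (\<exists>W\<subseteq>{..<q}. card W = k \<and> independent adj W)"
proof
  let ?C = "set [0..<Suc q]" and ?R = "list_order [0..<Suc q]"
  have C: "?C = {..q}" by auto
  assume "solvable_inst (seq_thiele \<omega>) (graph_inst q adj k)"
  then obtain C' where C': "C' \<subseteq> ?C - {q}" "card C' \<le> q - k" "k \<le> card (?C - C')"
    and win: "\<And>w. w \<in> seq_thiele \<omega> (?C - C') (restrict_votes (?C - C') votes)
      (Restr ?R (?C - C')) k \<Longrightarrow> w \<inter> {q} = {}"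
    by (auto simp: graph_inst_def dcdc_solvable_def votes_def simp del: upt_Suc set_upt)
  define X where "X = ?C - C'"
  have X: "X \<subseteq> {..q}" "q \<in> X" using C' C by (auto simp: X_def simp del: upt_Suc)
  have "linear_order_on X (Restr ?R X)"
    using linear_order_on_subset[OF linear_order_on_list_order[of "[0..<Suc q]"]] X C by simp
  moreover have "finite X" using X(1) finite_subset by blast
  \<comment> \<open>A winning committee must be exhibited, since the control condition would hold
    vacuously without one.\<close>
  ultimately obtain w where "w \<in> seq_thiele \<omega> X (restrict_votes X votes) (Restr ?R X) k"
    using seq_thiele_singleton C'(3) unfolding X_def[symmetric] by (metis singletonI)
  then have w: "seq_reach \<omega> X (restrict_votes X votes) (Restr ?R X) w" "card w = k" "q \<notin> w"
    using win unfolding X_def[symmetric] by (auto simp: seq_thiele_def)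
  have "w \<subseteq> {..q}" using seq_reach_subset[OF w(1)] X(1) by blast
  then have "w \<subseteq> {..<q}" using w(3) by (auto simp: le_less)
  then show "\<exists>W\<subseteq>{..<q}. card W = k \<and> independent adj W"
    using seq_reach_independent[OF X w(1,3)] w(2) by blast
next
  let ?C = "set [0..<Suc q]" and ?R = "list_order [0..<Suc q]"
  assume "\<exists>W\<subseteq>{..<q}. card W = k \<and> independent adj W"
  then obtain W where W: "W \<subseteq> {..<q}" "card W = k" "independent adj W" by blast
  have finW: "finite W" using W(1) finite_subset by blast
  have X: "?C - ({..<q} - W) = insert q W" using W(1) by auto
  have "dcdc_solvable (seq_thiele \<omega>) ?C votes ?R k {q} (q - k)"
    unfolding dcdc_solvable_def
  proof (intro exI[of _ "{..<q} - W"] conjI ballI, unfold X)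
    show "card ({..<q} - W) \<le> q - k" using W finW by (simp add: card_Diff_subset)
    show "k \<le> card (insert q W)" using W(2) finW by (metis card_insert_le)
    fix w assume "w \<in> seq_thiele \<omega> (insert q W) (restrict_votes (insert q W) votes)
      (Restr ?R (insert q W)) k"
    then show "w \<inter> {q} = {}"
      using independent_seq_reach[OF W(1,3)] W(2) by (simp add: seq_thiele_def del: upt_Suc)
  qed auto
  then show "solvable_inst (seq_thiele \<omega>) (graph_inst q adj k)"
    by (simp add: graph_inst_def votes_def del: upt_Suc set_upt)
qed

end

section \<open>From p-WD to independent set\<close>

text \<open>Positions start at 1, so that \<open>0\<close> and \<open>Suc (length T)\<close> are
  free to serve as end points.\<close>

definition position :: "'a list \<Rightarrow> 'a \<Rightarrow> nat" where
  "position T b = Suc (length (takeWhile (\<lambda>c. c \<noteq> b) T))"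

lemma position_nth: "distinct T \<Longrightarrow> j < length T \<Longrightarrow> position T (T ! j) = Suc j"
  unfolding position_def
  by (subst takeWhile_eq_take_P_nth[of j]) (auto simp: nth_eq_iff_index_eq)

lemma position_le: "b \<in> set T \<Longrightarrow> position T b \<le> length T"
  unfolding position_def by (induction T) auto

lemma inj_on_position: "distinct T \<Longrightarrow> inj_on (position T) (set T)"
  by (auto simp: inj_on_def in_set_conv_nth position_nth)

lemma position_image: "distinct T \<Longrightarrow> position T ` set T = {1..length T}"
  by (auto simp: in_set_conv_nth position_nth image_iff Bex_def)
    (metis Suc_le_D Suc_le_eq position_nth)

text \<open>
  A solution of p-WD is represented by the strictly increasing function that maps \<open>0\<close> to \<open>0\<close>,
  \<open>i\<close> to the position of the \<open>i\<close>-th element and \<open>k + 1\<close> to \<open>N + 1\<close>.  A finite list \<open>K\<close> of entries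
  of its graph can certify membership of a tuple by an entry, and non-membership by two
  consecutive entries that enclose the position of the tuple.
\<close>

primrec known :: "nat list list list \<Rightarrow> nat list list \<Rightarrow> (nat \<times> nat) list \<Rightarrow> nat list \<Rightarrow> qf \<Rightarrow>
    bool \<Rightarrow> bool" where
  "known rels T K a (Rel i ys) v \<longleftrightarrow>
    (map (nth_default 0 a) ys \<in> set (nth_default [] rels i)) = v"
| "known rels T K a (SetVar ys) v \<longleftrightarrow>
    (if v then \<exists>e\<in>set K. snd e = position T (map (nth_default 0 a) ys)
     else \<exists>e\<in>set K. \<exists>e'\<in>set K. fst e' = Suc (fst e) \<and>
       snd e < position T (map (nth_default 0 a) ys) \<and>
       position T (map (nth_default 0 a) ys) < snd e')"
| "known rels T K a (Eq y z) v \<longleftrightarrow> (nth_default 0 a y = nth_default 0 a z) = v"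
| "known rels T K a (Neg \<psi>) v \<longleftrightarrow> known rels T K a \<psi> (\<not> v)"
| "known rels T K a (Conj \<psi> \<chi>) v \<longleftrightarrow>
    (if v then known rels T K a \<psi> True \<and> known rels T K a \<chi> True
     else known rels T K a \<psi> False \<or> known rels T K a \<chi> False)"
| "known rels T K a (Disj \<psi> \<chi>) v \<longleftrightarrow>
    (if v then known rels T K a \<psi> True \<or> known rels T K a \<chi> True
     else known rels T K a \<psi> False \<and> known rels T K a \<chi> False)"

text \<open>The argument \<open>v\<close> carries negations down to the atoms, so \<open>K\<close>
  is only ever asked to contain entries.\<close>

lemma known_mono: "known rels T K a \<psi> v \<Longrightarrow> set K \<subseteq> set K' \<Longrightarrow> known rels T K' a \<psi> v"
  by (induction \<psi> arbitrary: v) (auto split: if_splits; meson subsetD)+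

text \<open>A bound on the number of entries needed to settle the formula: one shows membership, two
  consecutive ones show non-membership, and a connective may need both operands settled.\<close>

primrec certificate_size :: "qf \<Rightarrow> nat" where
  "certificate_size (Rel i ys) = 0"
| "certificate_size (SetVar ys) = 2"
| "certificate_size (Eq y z) = 0"
| "certificate_size (Neg \<psi>) = certificate_size \<psi>"
| "certificate_size (Conj \<psi> \<chi>) = certificate_size \<psi> + certificate_size \<chi>"
| "certificate_size (Disj \<psi> \<chi>) = certificate_size \<psi> + certificate_size \<chi>"

lemma set_n_lists_upt: "set (List.n_lists s [0..<n]) = tuples n s"
  by (auto simp: set_n_lists tuples_def)

section \<open>Certificates taken from an increasing function\<close>

definition graph_on :: "(nat \<Rightarrow> nat) \<Rightarrow> nat list \<Rightarrow> (nat \<times> nat) list" where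
  "graph_on h Q = map (\<lambda>i. (i, h i)) Q"

lemma map_fst_graph_on [simp]: "map fst (graph_on h Q) = Q"
  by (simp add: graph_on_def o_def)

text \<open>Relates a relation \<open>S\<close> to the function \<open>h\<close> representing it
  without saying which came first: one direction of the equivalence builds \<open>h\<close> from
  \<open>S\<close>, the other \<open>S\<close> from \<open>h\<close>.\<close>

locale increasing_solution =
  fixes n s k :: nat and T :: "nat list list" and h :: "nat \<Rightarrow> nat" and S :: "nat list set"
  assumes T: "distinct T" "set T = tuples n s"
    and h: "strict_mono_on {..Suc k} h" "h 0 = 0" "h (Suc k) = Suc (length T)"
    and S: "S \<subseteq> tuples n s" "position T ` S = h ` {1..k}"
begin

lemma mem_S_iff:
  assumes "b \<in> tuples n s"
  shows "b \<in> S \<longleftrightarrow> (\<exists>i\<in>{1..k}. h i = position T b)"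
proof
  assume "\<exists>i\<in>{1..k}. h i = position T b"
  then have "position T b \<in> position T ` S" unfolding S(2) by force
  then obtain c where "c \<in> S" "position T c = position T b" by auto
  then show "b \<in> S" using inj_on_position[OF T(1)] assms S(1) T(2) by (metis inj_onD subsetD)
next
  assume "b \<in> S"
  then have "position T b \<in> h ` {1..k}" using S(2) by blast
  then show "\<exists>i\<in>{1..k}. h i = position T b" by auto
qed

lemma h_less_iff: "i \<le> Suc k \<Longrightarrow> j \<le> Suc k \<Longrightarrow> h i < h j \<longleftrightarrow> i < j"
  using h(1) by (simp add: strict_mono_on_less)

lemma position_bounds: "b \<in> tuples n s \<Longrightarrow> 0 < position T b \<and> position T b < Suc (length T)"
  using position_le[of b T] T(2) by (auto simp: position_def)

text \<open>Without a gap, the values of \<open>h\<close> would by induction stay below the position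
  of \<open>b\<close>, although the last one exceeds all positions.\<close>

lemma gap_exists:
  assumes b: "b \<in> tuples n s" "b \<notin> S"
  shows "\<exists>i\<le>k. h i < position T b \<and> position T b < h (Suc i)"
proof (rule ccontr)
  assume no_gap: "\<not> ?thesis"
  have "h i < position T b" if "i \<le> Suc k" for i
    using that
  proof (induction i)
    case 0
    show ?case using position_bounds[OF b(1)] h(2) by simp
  next
    case (Suc i)
    then have le: "h (Suc i) \<le> position T b" using no_gap by (metis Suc_le_mono Suc_leD not_le)
    have "h (Suc i) \<noteq> position T b"
    \<comment> \<open>For \<open>i = k\<close> the value is the end point beyond all positions; for
      smaller \<open>i\<close> equality would put \<open>b\<close> into \<open>S\<close>.\<close>
    proof (cases "i = k")
      case True
      then show ?thesis using position_bounds[OF b(1)] h(3) by simp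
    next
      case False
      then show ?thesis using Suc.prems mem_S_iff[OF b(1)] b(2) by auto
    qed
    then show ?case using le by simp
  qed
  then have "h (Suc k) < position T b" by simp
  then show False using position_bounds[OF b(1)] h(3) by simp
qed

context
  fixes \<tau> :: "nat list" and r :: nat and rels :: "nat list list list" and a :: "nat list"
  assumes rels: "length rels = length \<tau>" and a: "a \<in> tuples n r"
begin

lemma args:
  assumes "set ys \<subseteq> {..<r}"
  shows "map (nth_default 0 a) ys = map ((!) a) ys" "map ((!) a) ys \<in> tuples n (length ys)"
proof -
  have "y < length a" if "y \<in> set ys" for y
    using assms a that by (auto simp: tuples_def)
  moreover have "a ! y < n" if "y < length a" for y
    using a nth_mem[OF that] by (auto simp: tuples_def)
  ultimately show "map (nth_default 0 a) ys = map ((!) a) ys"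
    "map ((!) a) ys \<in> tuples n (length ys)"
    by (auto simp: nth_default_def tuples_def)
qed

lemma known_sound:
  assumes "wf_qf \<tau> s r \<psi>" "set Q \<subseteq> {..Suc k}" "known rels T (graph_on h Q) a \<psi> v"
  shows "sat (map set rels) S a \<psi> = v"
  using assms(1,3)
proof (induction \<psi> arbitrary: v)
  case (Rel i ys)
  then show ?case by (simp add: args rels nth_default_nth)
next
  case (SetVar ys)
  define b where "b = map ((!) a) ys"
  have b: "b \<in> tuples n s" "map (nth_default 0 a) ys = b"
    using SetVar.prems(1) args[of ys] by (auto simp: b_def)
  have "b \<in> S \<longleftrightarrow> v"
  proof (cases v)
    case True
    then obtain i where i: "i \<le> Suc k" "h i = position T b"
      using SetVar.prems(2) b(2) assms(2) by (auto simp: graph_on_def)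
    \<comment> \<open>The values at the two end points are not positions of tuples.\<close>
    then have "i \<noteq> 0" "i \<noteq> Suc k" using position_bounds[OF b(1)] h(2,3) by (metis less_irrefl)+
    then have "i \<in> {1..k}" using i(1) by auto
    then show ?thesis using mem_S_iff[OF b(1)] i(2) True by blast
  next
    case False
    then obtain i where i: "Suc i \<le> Suc k" "h i < position T b" "position T b < h (Suc i)"
      using SetVar.prems(2) b(2) assms(2) by (auto simp: graph_on_def)
    have "h j \<noteq> position T b" if "j \<in> {1..k}" for j
    proof
      assume j: "h j = position T b"
      then have "i < j" "j < Suc i" using i that h_less_iff[of i j] h_less_iff[of j "Suc i"] by auto
      then show False by simp
    qed
    then show ?thesis using mem_S_iff[OF b(1)] False by blast
  qed
  then show ?case by (simp add: b_def)
next
  case (Eq y z)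
  then show ?case using args(1)[of "[y, z]"] by auto
qed (auto split: if_splits)

text \<open>Atoms are settled by a value of \<open>h\<close> or by a gap between two consecutive
  values. For connectives the argument lists are concatenated, and \<open>known_mono\<close> keeps
  both parts valid.\<close>

lemma known_complete:
  assumes "wf_qf \<tau> s r \<psi>"
  shows "\<exists>Q. set Q \<subseteq> {..Suc k} \<and> length Q \<le> certificate_size \<psi> \<and>
    known rels T (graph_on h Q) a \<psi> (sat (map set rels) S a \<psi>)"
  using assms
proof (induction \<psi>)
  case (Rel i ys)
  then show ?case by (intro exI[of _ "[]"]) (simp add: args rels nth_default_nth)
next
  case (SetVar ys)
  define b where "b = map ((!) a) ys"
  have b: "b \<in> tuples n s" "map (nth_default 0 a) ys = b"
    using SetVar.prems(1) args[of ys] by (auto simp: b_def)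
  show ?case
  proof (cases "b \<in> S")
    case True
    then obtain i where "i \<in> {1..k}" "h i = position T b" using mem_S_iff[OF b(1)] by blast
    then show ?thesis using True
      by (intro exI[of _ "[i]"]) (simp add: graph_on_def b(2) flip: b_def)
  next
    case False
    then obtain i where "i \<le> k" "h i < position T b" "position T b < h (Suc i)"
      using gap_exists[OF b(1)] by blast
    then show ?thesis using False
      by (intro exI[of _ "[i, Suc i]"]) (simp add: graph_on_def b(2) flip: b_def)
  qed
next
  case (Eq y z)
  then show ?case using args(1)[of "[y, z]"] by (intro exI[of _ "[]"]) auto
next
  case (Neg \<psi>)
  then show ?case by simp
next
  case (Conj \<psi> \<chi>)
  then obtain Q Q' where Q: "set Q \<subseteq> {..Suc k}" "length Q \<le> certificate_size \<psi>"
      "known rels T (graph_on h Q) a \<psi> (sat (map set rels) S a \<psi>)"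
    and Q': "set Q' \<subseteq> {..Suc k}" "length Q' \<le> certificate_size \<chi>"
      "known rels T (graph_on h Q') a \<chi> (sat (map set rels) S a \<chi>)" by auto
  have "known rels T (graph_on h (Q @ Q')) a \<psi> (sat (map set rels) S a \<psi>)"
    "known rels T (graph_on h (Q @ Q')) a \<chi> (sat (map set rels) S a \<chi>)"
    using known_mono[OF Q(3)] known_mono[OF Q'(3)] by (auto simp: graph_on_def)
  then show ?case using Q Q' by (intro exI[of _ "Q @ Q'"]) auto
next
  case (Disj \<psi> \<chi>)
  then obtain Q Q' where Q: "set Q \<subseteq> {..Suc k}" "length Q \<le> certificate_size \<psi>"
      "known rels T (graph_on h Q) a \<psi> (sat (map set rels) S a \<psi>)"
    and Q': "set Q' \<subseteq> {..Suc k}" "length Q' \<le> certificate_size \<chi>"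
      "known rels T (graph_on h Q') a \<chi> (sat (map set rels) S a \<chi>)" by auto
  have "known rels T (graph_on h (Q @ Q')) a \<psi> (sat (map set rels) S a \<psi>)"
    "known rels T (graph_on h (Q @ Q')) a \<chi> (sat (map set rels) S a \<chi>)"
    using known_mono[OF Q(3)] known_mono[OF Q'(3)] by (auto simp: graph_on_def)
  then show ?case using Q Q' by (intro exI[of _ "Q @ Q'"]) auto
qed

end

end

section \<open>The graph of partial increasing functions\<close>

definition order_ok :: "nat \<times> nat \<Rightarrow> nat \<times> nat \<Rightarrow> bool" where
  "order_ok e e' \<longleftrightarrow> (fst e < fst e') = (snd e < snd e') \<and> (fst e' < fst e) = (snd e' < snd e)"

text \<open>As \<open>order_ok\<close> compares in both directions, equal arguments also force equal
  values. Lists that clash neither with themselves nor with each other are parts of one strictly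
  increasing partial function.\<close>

definition clash :: "(nat \<times> nat) list \<Rightarrow> (nat \<times> nat) list \<Rightarrow> bool" where
  "clash K K' \<longleftrightarrow> (\<exists>e\<in>set K. \<exists>e'\<in>set K'. \<not> order_ok e e')"

text \<open>The end point conditions are built into the entries, so that \<open>clash\<close> has to
  compare orders only.\<close>

definition entries :: "nat \<Rightarrow> nat \<Rightarrow> (nat \<times> nat) list" where
  "entries k N = filter (\<lambda>e. (fst e = 0) = (snd e = 0) \<and> (fst e = Suc k) = (snd e = Suc N))
    (List.product [0..<Suc (Suc k)] [0..<Suc (Suc N)])"

text \<open>The \<open>Suc\<close> makes the lists nonempty even for formulas without
  \<open>SetVar\<close>, so that each argument can occur in a vertex. Excluding self-clashes makes
  the adjacency irreflexive.\<close>

definition vertices :: "nat \<Rightarrow> nat \<Rightarrow> qf \<Rightarrow> nat \<Rightarrow> nat list list list \<Rightarrow> nat \<Rightarrow> (nat \<times> nat) list list" where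
  "vertices s r \<psi> n rels k =
    filter (\<lambda>K. \<not> clash K K \<and>
        (\<forall>a\<in>set (List.n_lists r [0..<n]). \<not> known rels (List.n_lists s [0..<n]) K a \<psi> False))
      (List.n_lists (Suc (certificate_size \<psi>)) (entries k (length (List.n_lists s [0..<n]))))"

lemma set_entries: "e \<in> set (entries k N) \<longleftrightarrow> fst e \<le> Suc k \<and> snd e \<le> Suc N \<and>
    (fst e = 0 \<longleftrightarrow> snd e = 0) \<and> (fst e = Suc k \<longleftrightarrow> snd e = Suc N)"
  unfolding entries_def by (cases e) (auto simp del: upt_Suc)

lemma distinct_vertices: "distinct (vertices s r \<psi> n rels k)"
  unfolding vertices_def entries_def
  by (intro distinct_filter distinct_n_lists distinct_product distinct_upt)

lemma set_vertices:
  "K \<in> set (vertices s r \<psi> n rels k) \<longleftrightarrow> length K = Suc (certificate_size \<psi>) \<and>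
    set K \<subseteq> set (entries k (length (List.n_lists s [0..<n]))) \<and> \<not> clash K K \<and>
    (\<forall>a\<in>tuples n r. \<not> known rels (List.n_lists s [0..<n]) K a \<psi> False)"
  unfolding vertices_def set_filter set_n_lists_upt by (auto simp: set_n_lists simp del: n_lists.simps)

lemma not_clash_self: "K \<in> set (vertices s r \<psi> n rels k) \<Longrightarrow> \<not> clash K K"
  by (simp add: vertices_def)

lemma increasing_function_exists:
  assumes "P \<subseteq> {1..N}" "card P = k"
  obtains h where "strict_mono_on {..Suc k} h" "h 0 = 0" "h (Suc k) = Suc N" "h ` {1..k} = P"
proof
  let ?xs = "sorted_list_of_set P"
  \<comment> \<open>The function lists \<open>P\<close> in increasing order, framed by the two end
    points.\<close>
  let ?h = "\<lambda>i. (0 # ?xs @ [Suc N]) ! i"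
  have fin: "finite P" using assms(1) finite_subset by blast
  have len: "length ?xs = k" using assms(2) by simp
  have set: "set ?xs = P" using fin by simp
  have sorted: "sorted_wrt (<) (0 # ?xs @ [Suc N])"
    using assms(1) set by (auto simp: sorted_wrt_append)
  show "strict_mono_on {..Suc k} ?h"
    using len by (intro strict_mono_onI sorted_wrt_nth_less[OF sorted]) auto
  show "?h 0 = 0" by simp
  show "?h (Suc k) = Suc N" using len by (simp add: nth_append)
  have "{1..k} = Suc ` {..<k}"
    by (metis One_nat_def image_Suc_lessThan)
  then have "?h ` {1..k} = (\<lambda>i. ?xs ! i) ` {..<k}"
    using len by (auto simp: image_image nth_append)
  also have "\<dots> = P" using len set by (metis lessThan_atLeast0 list.set_map map_nth set_upt)
  finally show "?h ` {1..k} = P" .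
qed

text \<open>A solution gives one vertex for each of the \<open>Suc (Suc k) ^ D\<close> argument
  lists. Conversely, vertices that do not clash and have the same argument list coincide, so an
  independent set of this size realizes every argument list, and its members combine to one
  increasing \<open>h\<close>.\<close>

theorem wd_iff_independent:
  fixes s r \<psi> n rels k
  defines "V \<equiv> vertices s r \<psi> n rels k" and "D \<equiv> Suc (certificate_size \<psi>)"
  assumes "wf_struct \<tau> n rels" "wf_qf \<tau> s r \<psi>"
  shows "(\<exists>S\<subseteq>tuples n s. card S = k \<and> (\<forall>a\<in>tuples n r. sat (map set rels) S a \<psi>)) \<longleftrightarrow>
    (\<exists>W\<subseteq>set V. card W = Suc (Suc k) ^ D \<and> independent clash W)"
proof
  define T where "T = List.n_lists s [0..<n]"
  have T: "distinct T" "set T = tuples n s"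
    by (auto simp: T_def distinct_n_lists set_n_lists_upt)
  have rels: "length rels = length \<tau>" using assms(3) by (simp add: wf_struct_def)
  let ?Qs = "{Q. set Q \<subseteq> {..<Suc (Suc k)} \<and> length Q = D}"
  have card_Qs: "card ?Qs = Suc (Suc k) ^ D" and fin_Qs: "finite ?Qs"
    by (simp_all add: card_lists_length_eq finite_lists_length_eq)
  {
    assume "\<exists>S\<subseteq>tuples n s. card S = k \<and> (\<forall>a\<in>tuples n r. sat (map set rels) S a \<psi>)"
    then obtain S where S: "S \<subseteq> tuples n s" "card S = k"
      and sat: "\<And>a. a \<in> tuples n r \<Longrightarrow> sat (map set rels) S a \<psi>" by blast
    have "position T ` S \<subseteq> {1..length T}" using position_image[OF T(1)] T(2) S(1) by blast
    moreover have "card (position T ` S) = k"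
      using card_image inj_on_subset[OF inj_on_position[OF T(1)]] S T(2) by metis
    ultimately obtain h where h: "strict_mono_on {..Suc k} h" "h 0 = 0"
      "h (Suc k) = Suc (length T)" "h ` {1..k} = position T ` S"
      by (rule increasing_function_exists)
    interpret increasing_solution n s k T h S
      by standard (use T h S in auto)
    have no_clash: "\<not> clash (graph_on h Q) (graph_on h Q')" if "Q \<in> ?Qs" "Q' \<in> ?Qs" for Q Q'
    proof -
      have "i \<le> Suc k" if "i \<in> set Q \<union> set Q'" for i
        using that \<open>Q \<in> ?Qs\<close> \<open>Q' \<in> ?Qs\<close> by force
      then show ?thesis by (auto simp: clash_def order_ok_def graph_on_def h_less_iff)
    qed
    have "graph_on h Q \<in> set V" if Q: "Q \<in> ?Qs" for Q
    proof -
      have sub: "set Q \<subseteq> {..Suc k}" using Q by force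
      have "(i, h i) \<in> set (entries k (length T))" if "i \<in> set Q" for i
      proof -
        have i: "i \<le> Suc k" using that sub by auto
        have "h i \<le> h (Suc k)" using h_less_iff[of "Suc k" i] i by (simp add: not_less)
        moreover have "h i = h 0 \<longleftrightarrow> i = 0" "h i = h (Suc k) \<longleftrightarrow> i = Suc k"
          using h_less_iff[of 0 i] h_less_iff[of i "Suc k"] i by auto
        ultimately show ?thesis using h(2,3) i by (simp add: set_entries)
      qed
      then have "set (graph_on h Q) \<subseteq> set (entries k (length T))" "length (graph_on h Q) = D"
        using Q by (auto simp: graph_on_def)
      moreover have "\<not> known rels T (graph_on h Q) a \<psi> False" if "a \<in> tuples n r" for a
        using known_sound[OF rels that assms(4) sub] sat[OF that] by blast
      ultimately show ?thesis
        using no_clash[OF Q Q] by (simp add: V_def set_vertices T_def D_def)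
    qed
    then have "graph_on h ` ?Qs \<subseteq> set V" by (rule image_subsetI)
    moreover have "inj_on (graph_on h) ?Qs"
      by (rule inj_on_inverseI[of _ "map fst"]) (rule map_fst_graph_on)
    then have "card (graph_on h ` ?Qs) = Suc (Suc k) ^ D" unfolding card_Qs[symmetric] by (rule card_image)
    moreover have "independent clash (graph_on h ` ?Qs)"
      unfolding independent_def using no_clash by blast
    ultimately show "\<exists>W\<subseteq>set V. card W = Suc (Suc k) ^ D \<and> independent clash W" by blast
  next
    assume "\<exists>W\<subseteq>set V. card W = Suc (Suc k) ^ D \<and> independent clash W"
    then obtain W where W: "W \<subseteq> set V" "card W = Suc (Suc k) ^ D" "independent clash W" by blast
    \<comment> \<open>The choice is unique wherever an argument occurs in \<open>W\<close>, since
      independence forces equal values for equal arguments.\<close>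
    define h where "h i = (SOME u. \<exists>K\<in>W. (i, u) \<in> set K)" for i
    have order: "order_ok e e'" if "K \<in> W" "K' \<in> W" "e \<in> set K" "e' \<in> set K'" for K K' e e'
      using W(3) that unfolding independent_def clash_def by blast
    have h_eq: "h i = u" if "K \<in> W" "(i, u) \<in> set K" for K i u
    proof -
      have "\<exists>K\<in>W. (i, h i) \<in> set K" unfolding h_def using that by (rule_tac someI_ex) blast
      then obtain K' where "K' \<in> W" "(i, h i) \<in> set K'" by blast
      from order[OF that(1) this(1) that(2) this(2)] show ?thesis by (simp add: order_ok_def)
    qed
    have graph: "graph_on h (map fst K) = K" if "K \<in> W" for K
      unfolding graph_on_def map_map by (rule map_idI) (use h_eq[OF that] in auto)
    have entry: "e \<in> set (entries k (length T))" if "K \<in> W" "e \<in> set K" for K e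
      using subsetD[OF W(1) that(1)] that(2) unfolding V_def T_def set_vertices by blast
    have "map fst ` W \<subseteq> ?Qs"
    proof
      fix Q assume "Q \<in> map fst ` W"
      then obtain K where K: "K \<in> W" "Q = map fst K" by blast
      have "fst e < Suc (Suc k)" if "e \<in> set K" for e
        using entry[OF K(1) that] unfolding set_entries by simp
      moreover have "length K = D" using subsetD[OF W(1) K(1)] unfolding V_def D_def set_vertices by blast
      ultimately show "Q \<in> ?Qs" unfolding K(2) by (simp add: image_subset_iff)
    qed
    \<comment> \<open>A vertex is recovered from its arguments through \<open>h\<close>; by
      counting, \<open>W\<close> then realizes all argument lists.\<close>
    moreover have "inj_on (map fst) W" by (rule inj_on_inverseI[of _ "graph_on h"]) (rule graph)
    then have "card (map fst ` W) = card ?Qs" using W(2) card_Qs by (simp add: card_image)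
    ultimately have image: "map fst ` W = ?Qs" using fin_Qs by (intro card_subset_eq)
    have mem: "graph_on h Q \<in> W" if "Q \<in> ?Qs" for Q
    proof -
      have "Q \<in> map fst ` W" unfolding image by (rule that)
      then obtain K where K: "Q = map fst K" "K \<in> W" by (rule imageE)
      show ?thesis unfolding K(1) graph[OF K(2)] by (rule K(2))
    qed
    have pairs: "\<exists>K\<in>W. (i, h i) \<in> set K" if "i \<le> Suc k" for i
    proof
      show "graph_on h (replicate D i) \<in> W" using that by (intro mem) auto
    qed (simp add: graph_on_def D_def)
    have mono: "strict_mono_on {..Suc k} h"
    proof (rule strict_mono_onI)
      fix i j assume "i \<in> {..Suc k}" "j \<in> {..Suc k}" "i < j"
      then obtain K K' where "K \<in> W" "K' \<in> W" "(i, h i) \<in> set K" "(j, h j) \<in> set K'"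
        using pairs by (metis atMost_iff)
      from order[OF this] show "h i < h j" using \<open>i < j\<close> by (simp add: order_ok_def)
    qed
    have "(h i = 0 \<longleftrightarrow> i = 0) \<and> (h i = Suc (length T) \<longleftrightarrow> i = Suc k) \<and> h i \<le> Suc (length T)"
      if "i \<le> Suc k" for i
    proof -
      obtain K where "K \<in> W" "(i, h i) \<in> set K" using pairs[OF \<open>i \<le> Suc k\<close>] by blast
      from entry[OF this] show ?thesis unfolding set_entries by simp
    qed
    note bounds = this
    have h: "h 0 = 0" "h (Suc k) = Suc (length T)" using bounds[of 0] bounds[of "Suc k"] by simp_all
    have "h i \<in> {1..length T}" if "i \<in> {1..k}" for i
      using bounds[of i] that by (simp add: Suc_le_eq)
    then have h_image: "h ` {1..k} \<subseteq> {1..length T}" by blast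
    define S where "S = {b \<in> set T. position T b \<in> h ` {1..k}}"
    have S: "position T ` S = h ` {1..k}"
    proof (intro equalityI subsetI)
      fix u assume u: "u \<in> h ` {1..k}"
      then have "u \<in> position T ` set T" using h_image unfolding position_image[OF T(1)] by (rule rev_subsetD)
      then obtain b where "b \<in> set T" "u = position T b" by blast
      then show "u \<in> position T ` S" using u by (simp add: S_def)
    qed (auto simp: S_def)
    have S_sub: "S \<subseteq> tuples n s" using T(2) by (auto simp: S_def)
    interpret increasing_solution n s k T h S
      by standard (fact T mono h S S_sub)+
    have "card S = card (position T ` S)"
      using T(2) card_image[OF inj_on_subset[OF inj_on_position[OF T(1)]], of S] S_sub
      by simp
    also have "\<dots> = k"
    proof -
      have "inj_on h {1..k}"
        by (rule inj_on_subset[OF strict_mono_on_imp_inj_on[OF mono]]) auto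
      then show ?thesis unfolding S by (simp add: card_image)
    qed
    finally have "card S = k" .
    moreover have "sat (map set rels) S a \<psi>" if a: "a \<in> tuples n r" for a
    proof (rule ccontr)
      assume "\<not> sat (map set rels) S a \<psi>"
      then obtain Q where Q: "set Q \<subseteq> {..Suc k}" "length Q \<le> certificate_size \<psi>"
        "known rels T (graph_on h Q) a \<psi> False"
        using known_complete[OF rels a assms(4)] by auto
      \<comment> \<open>Padding with the argument \<open>0\<close> reaches the exact length
        \<open>D\<close>; more entries do not invalidate a certificate.\<close>
      define Q' where "Q' = Q @ replicate (D - length Q) 0"
      have "Q' \<in> ?Qs" using Q(1,2) by (auto simp: Q'_def D_def less_Suc_eq_le)
      then have "graph_on h Q' \<in> set V" using mem W(1) by blast
      then have "\<not> known rels T (graph_on h Q') a \<psi> False"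
        using a by (simp add: V_def set_vertices T_def)
      then show False using known_mono[OF Q(3)] by (auto simp: Q'_def graph_on_def)
    qed
    ultimately show "\<exists>S\<subseteq>tuples n s. card S = k \<and> (\<forall>a\<in>tuples n r. sat (map set rels) S a \<psi>)"
      using S_sub by blast
  }
qed

section \<open>The reduction\<close>

lemma ptime_product [ptime_intros]:
  assumes "ptime L" "ptime M"
  shows "ptime (\<lambda>x. List.product (L x) (M x))"
  unfolding product_concat_map
  by (intro ptime_concat ptime_map ptime_comp[OF assms(2)] assms ptime_intros)

lemma ptime_mem [ptime_intros]:
  assumes "ptime f" "ptime L"
  shows "ptime (\<lambda>x. f x \<in> set (L x))"
proof -
  have "ptime (\<lambda>x. \<exists>e\<in>set (L x). e = f x)"
    by (intro ptime_Bex ptime_eq ptime_comp[OF assms(1)] assms ptime_intros)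
  then show ?thesis by (metis (no_types, lifting) ext)
qed

lemma ptime_position [ptime_intros]:
  assumes "ptime T" "ptime b"
  shows "ptime (\<lambda>x. position (T x) (b x))"
proof -
  have eq: "foldr (\<lambda>c m. if c = b then 0 else Suc m) xs 0 = length (takeWhile (\<lambda>c. c \<noteq> b) xs)"
    for b :: 'b and xs
    by (induction xs) auto
  have "ptime (\<lambda>x. foldr (\<lambda>c m. if c = b x then 0 else Suc m) (T x) 0)"
  proof (rule ptime_foldr[where G = "\<lambda>x. 1 + 2 * sz (T x)"])
    show "ptime (\<lambda>z. if fst (snd z) = b (fst z) then 0 else Suc (snd (snd z)))"
      by (intro ptime_If ptime_eq ptime_comp[OF assms(2)] ptime_intros)
    show "polyb (\<lambda>x. 1 + 2 * sz (T x))"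
      by (intro polyb_add polyb_mult polyb_const ptime_polyb_sz assms)
    fix x pre suf
    assume "T x = pre @ suf"
    then have "length (takeWhile (\<lambda>c. c \<noteq> b x) suf) \<le> sz (T x)"
      using length_takeWhile_le[of "\<lambda>c. c \<noteq> b x" suf] length_less_sz[of "T x"] by simp
    then show "sz (foldr (\<lambda>c m. if c = b x then 0 else Suc m) suf 0) \<le> 1 + 2 * sz (T x)"
      unfolding eq by simp
  qed (intro ptime_intros assms)+
  then show ?thesis unfolding eq position_def by (rule ptime_Suc)
qed

lemma ptime_nth_defaults [ptime_intros]:
  "ptime A \<Longrightarrow> ptime (\<lambda>x. map (nth_default d (A x)) ys)"
  by (induction ys) (auto intro: ptime_const ptime_Cons ptime_nth_default)

text \<open>The formula is fixed, so the program is assembled by induction on it and need not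
  interpret it.\<close>

lemma ptime_known:
  assumes "ptime R" "ptime T" "ptime K" "ptime A"
  shows "ptime (\<lambda>x. known (R x) (T x) (K x) (A x) \<psi> v)"
proof (induction \<psi> arbitrary: v)
  case (Rel i ys)
  show ?case unfolding known.simps by (intro ptime_intros assms)
next
  case (SetVar ys)
  have pos: "ptime (\<lambda>x. position (T x) (map (nth_default 0 (A x)) ys))"
    by (intro ptime_intros assms)
  have "ptime (\<lambda>x. \<exists>e\<in>set (K x). snd e = position (T x) (map (nth_default 0 (A x)) ys))"
    by (intro ptime_Bex ptime_eq ptime_comp[OF pos] ptime_intros assms)
  moreover have "ptime (\<lambda>x. \<exists>e\<in>set (K x). \<exists>e'\<in>set (K x). fst e' = Suc (fst e) \<and>
       snd e < position (T x) (map (nth_default 0 (A x)) ys) \<and>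
       position (T x) (map (nth_default 0 (A x)) ys) < snd e')"
    by (intro ptime_Bex ptime_conj ptime_eq ptime_less ptime_comp[OF pos] ptime_comp[OF assms(3)]
        ptime_intros assms)
  ultimately show ?case by (cases v) simp_all
next
  case (Eq y z)
  show ?case unfolding known.simps by (intro ptime_intros assms)
next
  case (Neg \<psi>)
  then show ?case by simp
next
  case (Conj \<psi> \<chi>)
  then show ?case by (cases v) (auto intro: ptime_conj ptime_disj)
next
  case (Disj \<psi> \<chi>)
  then show ?case by (cases v) (auto intro: ptime_conj ptime_disj)
qed

lemma ptime_clash [ptime_intros]:
  assumes "ptime K" "ptime L"
  shows "ptime (\<lambda>x. clash (K x) (L x))"
  unfolding clash_def order_ok_def
  by (intro ptime_Bex ptime_not ptime_conj ptime_eq ptime_less ptime_comp[OF assms(2)]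
      ptime_intros assms)

lemma ptime_entries [ptime_intros]:
  assumes "ptime k" "ptime N"
  shows "ptime (\<lambda>x. entries (k x) (N x))"
  unfolding entries_def
  by (intro ptime_filter ptime_conj ptime_eq ptime_product ptime_Suc ptime_upt
      ptime_comp[OF assms(1)] ptime_comp[OF assms(2)] ptime_intros assms)

text \<open>Exhaustive listing is affordable because the lengths \<open>r\<close>, \<open>s\<close>
  and \<open>Suc (certificate_size \<psi>)\<close> of the lists depend on the formula only.\<close>

lemma ptime_vertices [ptime_intros]:
  assumes "ptime n" "ptime rels" "ptime k"
  shows "ptime (\<lambda>x. vertices s r \<psi> (n x) (rels x) (k x))"
  unfolding vertices_def
  by (intro ptime_filter ptime_conj ptime_not ptime_clash ptime_Ball ptime_known ptime_n_lists
      ptime_upt ptime_entries ptime_length ptime_comp[OF assms(1)] ptime_comp[OF assms(2)]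
      ptime_fst ptime_snd ptime_id assms)

text \<open>Every tree is decoded to something; trees that are no encodings are detected because
  encoding the result does not give them back.\<close>

definition decode :: "data \<Rightarrow> nat \<times> nat list list list" where
  "decode x = (length (spine (nth_default Atom (spine x) 0)),
    case spine x of [] \<Rightarrow> []
    | _ # ds \<Rightarrow> map (\<lambda>d. map (\<lambda>t. map (\<lambda>e. length (spine e)) (spine t)) (spine d)) ds)"

lemma ptime_decode [ptime_intros]:
  assumes "ptime f"
  shows "ptime (\<lambda>x. decode (f x))"
proof -
  have "ptime decode" unfolding decode_def[abs_def] by (intro ptime_intros)
  from ptime_comp[OF this assms] show ?thesis .
qed

lemma enc_struct_eq: "enc_struct n rels = enc (n, rels)"
  by (simp add: enc_struct_def enc_list_def enc_nat_def enc_list_def[abs_def] enc_nat_def[abs_def])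

lemma length_spine_num [simp]: "length (spine (num n)) = n"
  by (induction n) auto

lemma decode_enc [simp]: "decode (enc (n, rels)) = (n, rels)"
proof -
  have "map (\<lambda>e. length (spine e)) (spine (enc t)) = t" for t :: "nat list"
    by (induction t) (auto simp: enc_nat_def)
  then have "map (\<lambda>t. map (\<lambda>e. length (spine e)) (spine t)) (spine (enc ts)) = ts"
    for ts :: "nat list list"
    by (induction ts) auto
  then have "map (\<lambda>d. map (\<lambda>t. map (\<lambda>e. length (spine e)) (spine t)) (spine d)) (spine (enc rels)) = rels"
    by (induction rels) auto
  then show ?thesis by (simp add: decode_def enc_nat_def)
qed

text \<open>A form of \<open>wf_struct\<close> with quantifiers over enumerated lists in place of
  indexing, so that the polynomial-time rules apply.\<close>

definition struct_ok :: "nat list \<Rightarrow> nat \<Rightarrow> nat list list list \<Rightarrow> bool" where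
  "struct_ok \<tau> n rels \<longleftrightarrow> 0 < n \<and> length rels = length \<tau> \<and>
    (\<forall>p\<in>set (enumerate 0 rels). \<forall>q\<in>set (enumerate 0 \<tau>). fst p = fst q \<longrightarrow>
      distinct (snd p) \<and> (\<forall>t\<in>set (snd p). length t = snd q \<and> (\<forall>e\<in>set t. e < n)))"

lemma struct_ok_iff: "struct_ok \<tau> n rels \<longleftrightarrow> wf_struct \<tau> n rels"
proof -
  have enum: "(\<forall>p\<in>set (enumerate 0 xs). P p) \<longleftrightarrow> (\<forall>i<length xs. P (i, xs ! i))" for xs :: "'b list" and P
    by (simp add: all_set_conv_all_nth nth_enumerate_eq)
  have tup: "set ts \<subseteq> tuples n m \<longleftrightarrow> (\<forall>t\<in>set ts. length t = m \<and> (\<forall>e\<in>set t. e < n))" for ts m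
    by (auto simp: tuples_def subset_iff)
  show ?thesis unfolding struct_ok_def wf_struct_def enum tup fst_conv snd_conv
    by (intro conj_cong refl) metis
qed

lemma ptime_struct_ok [ptime_intros]:
  assumes "ptime n" "ptime rels"
  shows "ptime (\<lambda>x. struct_ok \<tau> (n x) (rels x))"
  unfolding struct_ok_def
  by (intro ptime_conj ptime_Ball ptime_imp ptime_eq ptime_less ptime_comp[OF assms(1)]
      ptime_intros assms)

text \<open>Vertices become numbers. The range conditions make the relation irreflexive on all
  numbers, even where \<open>V ! i\<close> is unspecified.\<close>

definition index_adj :: "('a \<Rightarrow> 'a \<Rightarrow> bool) \<Rightarrow> 'a list \<Rightarrow> nat \<Rightarrow> nat \<Rightarrow> bool" where
  "index_adj adj V i j \<longleftrightarrow> i < length V \<and> j < length V \<and> adj (V ! i) (V ! j)"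

lemma independent_index_adj:
  assumes "distinct V"
  shows "(\<exists>W\<subseteq>{..<length V}. card W = k \<and> independent (index_adj adj V) W) \<longleftrightarrow>
    (\<exists>W\<subseteq>set V. card W = k \<and> independent adj W)"
proof -
  have inj: "inj_on ((!) V) {..<length V}" using assms by (auto simp: inj_on_def nth_eq_iff_index_eq)
  have "independent (index_adj adj V) W \<longleftrightarrow> independent adj ((!) V ` W)" if "W \<subseteq> {..<length V}" for W
    using that by (auto simp: independent_def index_adj_def subset_iff)
  moreover have "card ((!) V ` W) = card W" if "W \<subseteq> {..<length V}" for W
    using card_image inj_on_subset[OF inj that] by blast
  moreover have "(!) V ` {..<length V} = set V" by (auto simp: set_conv_nth)
  ultimately show ?thesis by (metis (no_types, lifting) subset_image_iff)
qed

text \<open>Carrying each vertex along with its number produces the votes without list access at a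
  varying index.\<close>

lemma pair_votes_enumerate:
  "concat (map (\<lambda>i. concat (map (pair_votes (index_adj adj V) i) [0..<length V])) [0..<length V]) =
    concat (map (\<lambda>p. concat (map (\<lambda>p'. if adj (snd p) (snd p') then [[fst p, fst p']]
      else [[fst p], [fst p']]) (enumerate 0 V))) (enumerate 0 V))"
proof -
  have "enumerate 0 V = map (\<lambda>i. (i, V ! i)) [0..<length V]"
    by (rule nth_equalityI) (auto simp: nth_enumerate_eq)
  then show ?thesis
    by (auto simp: o_def pair_votes_def index_adj_def intro!: arg_cong[where f = concat])
qed

text \<open>Inputs that encode no structure and graphs with fewer than \<open>m\<close> vertices are
  negative, and are sent to \<open>(Atom, 0)\<close>, which encodes no election. Otherwise the
  committee size \<open>m\<close> is at most the number of vertices, as \<open>graph_inst\<close>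
  requires.\<close>

definition wd_to_dcdc :: "nat list \<Rightarrow> nat \<Rightarrow> nat \<Rightarrow> qf \<Rightarrow> data \<times> nat \<Rightarrow> data \<times> nat" where
  "wd_to_dcdc \<tau> s r \<psi> z =
    (let n = fst (decode (fst z)); rels = snd (decode (fst z));
         V = vertices s r \<psi> n rels (snd z);
         m = Suc (Suc (snd z)) ^ Suc (certificate_size \<psi>)
     in if enc (n, rels) = fst z \<and> struct_ok \<tau> n rels \<and> \<not> length V < m
        then (enc_inst (graph_inst (length V) (index_adj clash V) m), Suc m)
        else (Atom, 0))"

section \<open>Correctness of the reduction to control by deletion\<close>

lemma enc_inst_eq:
  "enc_inst (cs, vs, k, js, l) = lst [enc cs, enc vs, enc k, enc js, enc l]"
  by (simp add: enc_list_def enc_nat_def enc_list_def[abs_def] enc_nat_def[abs_def])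

lemma enc_inst_inject: "enc_inst I = enc_inst I' \<Longrightarrow> I = I'"
  by (cases I; cases I') (auto simp: enc_inst_eq enc_eq_iff simp del: enc_inst.simps)

lemma enc_inst_neq_Atom: "enc_inst I \<noteq> Atom"
  by (cases I) simp

lemma mem_DCDC:
  "(enc_inst I, remaining I) \<in> DCDC \<psi> \<longleftrightarrow> wf_inst I \<and> solvable_inst \<psi> I"
  "(enc_inst I, remaining I) \<in> DCDC_single \<psi> \<longleftrightarrow>
    wf_inst I \<and> card (distinguished I) = 1 \<and> solvable_inst \<psi> I"
  unfolding DCDC_def DCDC_single_def mem_Collect_eq by (metis enc_inst_inject prod.inject)+

lemma Atom_not_in_DCDC: "(Atom, k) \<notin> DCDC \<psi>" "(Atom, k) \<notin> DCDC_single \<psi>"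
  unfolding DCDC_def DCDC_single_def mem_Collect_eq by (metis enc_inst_neq_Atom prod.inject)+

lemma ptime_graph_inst:
  assumes "ptime V" "ptime m"
  shows "ptime (\<lambda>x. enc_inst (graph_inst (length (V x)) (index_adj clash (V x)) (m x)))"
  unfolding graph_inst_def graph_votes_def enc_inst_eq pair_votes_enumerate
  by (intro ptime_lst ptime_Cons ptime_enc ptime_upt ptime_append ptime_concat ptime_map
      ptime_enumerate ptime_If ptime_clash ptime_comp[OF assms(1)] ptime_intros assms)

lemma ptime_wd_to_dcdc: "ptime (wd_to_dcdc \<tau> s r \<psi>)"
  unfolding wd_to_dcdc_def[abs_def] Let_def
  by (intro ptime_If ptime_Pair ptime_graph_inst ptime_intros)

lemma wd_to_dcdc_correct:
  fixes \<omega> :: "nat \<Rightarrow> real"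
  assumes "is_thiele \<omega>" "\<omega> 2 < 2 * \<omega> 1" "wf_qf \<tau> s r \<psi>"
  shows "(x, k) \<in> WD \<tau> s r \<psi> \<longleftrightarrow> wd_to_dcdc \<tau> s r \<psi> (x, k) \<in> DCDC (seq_thiele \<omega>)" (is ?A)
    and "(x, k) \<in> WD \<tau> s r \<psi> \<longleftrightarrow> wd_to_dcdc \<tau> s r \<psi> (x, k) \<in> DCDC_single (seq_thiele \<omega>)" (is ?B)
proof -
  obtain n rels where dec: "decode x = (n, rels)" by (cases "decode x")
  define V where "V = vertices s r \<psi> n rels k"
  define m where "m = Suc (Suc k) ^ Suc (certificate_size \<psi>)"
  define I where "I = graph_inst (length V) (index_adj clash V) m"
  have f: "wd_to_dcdc \<tau> s r \<psi> (x, k) =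
    (if enc (n, rels) = x \<and> wf_struct \<tau> n rels \<and> m \<le> length V then (enc_inst I, Suc m) else (Atom, 0))"
    by (simp add: wd_to_dcdc_def Let_def dec V_def m_def I_def struct_ok_iff not_less)
  have WD: "(x, k) \<in> WD \<tau> s r \<psi> \<longleftrightarrow> enc (n, rels) = x \<and> wf_struct \<tau> n rels \<and>
    (\<exists>W\<subseteq>set V. card W = m \<and> independent clash W)"
  proof -
    have "(x, k) \<in> WD \<tau> s r \<psi> \<longleftrightarrow> enc (n, rels) = x \<and> wf_struct \<tau> n rels \<and>
      (\<exists>S\<subseteq>tuples n s. card S = k \<and> (\<forall>a\<in>tuples n r. sat (map set rels) S a \<psi>))"
      (is "_ \<longleftrightarrow> _ \<and> _ \<and> ?sol n rels")
    proof -
      have "(x, k) \<in> WD \<tau> s r \<psi> \<longleftrightarrow>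
        (\<exists>n rels. x = enc (n, rels) \<and> wf_struct \<tau> n rels \<and> ?sol n rels)"
        unfolding WD_def enc_struct_eq by blast
      then show ?thesis using dec by (metis decode_enc prod.inject)
    qed
    then show ?thesis
      unfolding V_def m_def using wd_iff_independent[OF _ assms(3)] by metis
  qed
  \<comment> \<open>This justifies the negative answer for graphs that are too small.\<close>
  have large: "m \<le> length V" if "W \<subseteq> set V" "card W = m" for W
    using card_mono[OF _ that(1)] that(2) card_length[of V] by simp
  have irrefl: "\<not> index_adj clash V i i" for i
    unfolding index_adj_def V_def by (metis not_clash_self nth_mem)
  interpret graph_election \<omega> "length V" "index_adj clash V"
    by standard (use assms irrefl in auto)
  have solvable: "solvable_inst (seq_thiele \<omega>) I \<longleftrightarrow> (\<exists>W\<subseteq>set V. card W = m \<and> independent clash W)"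
    if "m \<le> length V"
    unfolding I_def solvable_graph_inst[OF that]
    by (rule independent_index_adj) (simp add: V_def distinct_vertices)
  have I: "wf_inst I" "remaining I = Suc m" "card (distinguished I) = 1" if "m \<le> length V"
    using wf_graph_inst[of "index_adj clash V" m "length V"] irrefl that
      remaining_graph_inst[OF that] by (auto simp: I_def graph_inst_def)
  have "(enc_inst I, Suc m) \<in> DCDC (seq_thiele \<omega>) \<longleftrightarrow> solvable_inst (seq_thiele \<omega>) I"
    "(enc_inst I, Suc m) \<in> DCDC_single (seq_thiele \<omega>) \<longleftrightarrow> solvable_inst (seq_thiele \<omega>) I"
    if "m \<le> length V"
    using I[OF that] mem_DCDC[of I "seq_thiele \<omega>"] by simp_all
  then show ?A ?B
    unfolding WD f using solvable large Atom_not_in_DCDC by (metis (lifting))+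
qed

section \<open>Composition with fpt-reductions\<close>

lemma ptime_computable: "ptime H \<Longrightarrow> computable H"
  unfolding ptime_def computable_def enc_nat_def by blast

lemma computable_comp:
  assumes "computable f" "computable g"
  shows "computable (\<lambda>n. f (g n))"
proof -
  obtain p q where "\<And>n. \<exists>t. exec p (num n) t (num (f n))" "\<And>n. \<exists>t. exec q (num n) t (num (g n))"
    using assms unfolding computable_def by metis
  then have "\<exists>t. exec (PSeq q p) (num n) t (num (f (g n)))" for n
    by (metis exec.Seq)
  then show ?thesis unfolding computable_def by blast
qed

text \<open>Monotonicity of \<open>H\<close> is needed because only the upper bound
  \<open>h k\<close> on the intermediate parameter is known.\<close>

lemma fpt_reducible_ptime:
  fixes f :: "data \<times> nat \<Rightarrow> data \<times> nat"
  assumes "fpt_reducible A B" "ptime f"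
    and correct: "\<And>x k. (x, k) \<in> B \<longleftrightarrow> f (x, k) \<in> C"
    and H: "\<And>x k. snd (f (x, k)) \<le> H k" "mono H" "ptime H"
  shows "fpt_reducible A C"
proof -
  obtain p g h c where gh: "computable g" "computable h"
    and p: "\<And>x k. \<exists>x' k' t. exec p (Node x (num k)) t (Node x' (num k')) \<and>
        t \<le> g k * len x ^ c \<and> k' \<le> h k \<and> ((x, k) \<in> A \<longleftrightarrow> (x', k') \<in> B)"
    using assms(1) unfolding fpt_reducible_def by blast
  obtain q T where T: "polyb T" and q: "\<And>z. exec q (enc z) (T z) (enc (f z))"
    using assms(2) unfolding ptime_def by blast
  obtain d where d: "\<And>z. T z \<le> (sz z + 2) ^ d" using T unfolding polyb_def by blast
  \<comment> \<open>The exponent \<open>Suc d\<close> pays for both runs, as the input of the second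
    is no larger than the cost of the first.\<close>
  define G where "G m = (m + 2) ^ Suc d" for m :: nat
  have "ptime G" unfolding G_def[abs_def] by (intro ptime_intros)
  have "\<exists>x'' k'' t. exec (PSeq p q) (Node x (num k)) t (Node x'' (num k'')) \<and>
      t \<le> G (g k) * len x ^ (c * Suc d) \<and> k'' \<le> H (h k) \<and> ((x, k) \<in> A \<longleftrightarrow> (x'', k'') \<in> C)"
    for x k
  proof -
    obtain x' k' t where t: "exec p (Node x (num k)) t (Node x' (num k'))"
      "t \<le> g k * len x ^ c" "k' \<le> h k" "(x, k) \<in> A \<longleftrightarrow> (x', k') \<in> B"
      using p by blast
    obtain x'' k'' where f: "f (x', k') = (x'', k'')" by (cases "f (x', k')")
    have "exec q (Node x' (num k')) (T (x', k')) (Node x'' (num k''))"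
      using q[of "(x', k')"] f by (simp add: enc_nat_def)
    from exec.Seq[OF t(1) this]
    have "exec (PSeq p q) (Node x (num k)) (Suc (t + T (x', k'))) (Node x'' (num k''))" .
    moreover have "Suc (t + T (x', k')) \<le> G (g k) * len x ^ (c * Suc d)"
    proof -
      have "sz (x', k') \<le> t" using exec_output_len[OF t(1)] by (simp add: sz_def enc_nat_def)
      then have "T (x', k') \<le> (t + 2) ^ d"
        using d[of "(x', k')"] by (meson add_le_mono1 le_trans power_mono zero_le)
      then have "Suc (t + T (x', k')) \<le> (t + 1) * 1 + 1 * (t + 2) ^ d" by simp
      also have "\<dots> \<le> (t + 1) * (t + 2) ^ d + 1 * (t + 2) ^ d"
        by (intro add_right_mono mult_le_mono2) simp
      also have "\<dots> = (t + 2) ^ Suc d" by (simp add: algebra_simps)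
      also have "\<dots> \<le> ((g k + 2) * len x ^ c) ^ Suc d"
      proof (rule power_mono)
        \<comment> \<open>Trees have positive size, so the summand 2 can be moved into the
          coefficient of \<open>len x ^ c\<close>.\<close>
        have "2 \<le> 2 * len x ^ c" by (simp add: Suc_le_eq)
        then show "t + 2 \<le> (g k + 2) * len x ^ c" using t(2) unfolding distrib_right by linarith
      qed simp
      also have "\<dots> = G (g k) * len x ^ (c * Suc d)"
        unfolding G_def by (simp only: power_mult_distrib power_mult)
      finally show ?thesis .
    qed
    moreover have "k'' \<le> H (h k)"
      using H(1)[of x' k'] f monoD[OF H(2) t(3)] by simp
    moreover have "(x, k) \<in> A \<longleftrightarrow> (x'', k'') \<in> C" using t(4) correct f by simp
    ultimately show ?thesis by blast
  qed
  moreover have "computable (\<lambda>k. G (g k))" "computable (\<lambda>k. H (h k))"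
    using gh computable_comp ptime_computable \<open>ptime G\<close> H(3) by auto
  ultimately show ?thesis unfolding fpt_reducible_def by blast
qed

text \<open>The target \<open>C\<close> is left open, so that one argument serves both
  \<open>DCDC\<close> and \<open>DCDC_single\<close>.\<close>

lemma wd_to_dcdc_reduces:
  assumes "fpt_reducible A (WD \<tau> s r \<psi>)"
    and "\<And>x k. (x, k) \<in> WD \<tau> s r \<psi> \<longleftrightarrow> wd_to_dcdc \<tau> s r \<psi> (x, k) \<in> C"
  shows "fpt_reducible A C"
proof (rule fpt_reducible_ptime[OF assms(1) ptime_wd_to_dcdc assms(2)])
  let ?H = "\<lambda>k. Suc (Suc (Suc k) ^ Suc (certificate_size \<psi>))"
  show "snd (wd_to_dcdc \<tau> s r \<psi> (x, k)) \<le> ?H k" for x k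
    by (simp add: wd_to_dcdc_def Let_def)
  show "mono ?H" by (intro monoI) (simp add: power_mono mult_le_mono del: power_Suc)
  show "ptime ?H" by (intro ptime_intros)
qed

theorem theorem19:
  fixes \<omega> :: "nat \<Rightarrow> real"
  assumes "is_thiele \<omega>" and "\<omega> 2 < 2 * \<omega> 1"
  shows "W1_hard (DCDC (seq_thiele \<omega>)) \<and> W1_hard (DCDC_single (seq_thiele \<omega>))"
proof -
  have "fpt_reducible A (DCDC (seq_thiele \<omega>)) \<and> fpt_reducible A (DCDC_single (seq_thiele \<omega>))"
    if A: "A \<in> W1" for A
  proof -
    obtain \<tau> s r \<psi> where \<psi>: "wf_qf \<tau> s r \<psi>" "fpt_reducible A (WD \<tau> s r \<psi>)"
      using A unfolding W1_def by blast
    show ?thesis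
      by (intro conjI wd_to_dcdc_reduces[OF \<psi>(2)] wd_to_dcdc_correct[OF assms \<psi>(1)])
  qed
  then show ?thesis unfolding W1_hard_def by blast
qed

end
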